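(* Let $K$ be a compact Hausdorff space such that the Banach lattice $C(K)$ has the lattice-lifting property. Then $K$ is a neighborhood retract of $(B_{C(K)^*},w^* )$, where $K$ is identified with its canonical homeomorphic copy in $(B_{C(K)^*},w^* )$ consisting of the evaluation functionals $h\mapsto h(t)$, $h\in C(K)$, for $t\in K$. If in addition $K$ is metrizable, then $K$ is an absolute neighborhood retract (ANR).
   Context: All Banach spaces are real; $B_E$ is the closed unit ball of $E$ and $w^*$ is the weak$^*$-topology. A lattice homomorphism between Banach lattices is a bounded linear operator preserving lattice operations. A sublattice means a closed vector sublattice. $C(K)$ is the Banach lattice of real-valued continuous functions on $K$ with the supremum norm and pointwise order. Free Banach lattice: for a Banach space $E$ and a positively homogeneous function $f:E^*\to\mathbb{R}$ (i.e. $f(\lambda x^* )=\lambda f(x^* )$ for $\lambda>0$), put $\|f\|_{FBL[E]}:=\sup\{\sum_{i=1}^n|f(x_i^* )|: n\in\mathbb{N},\ x_1^*,\dots,x_n^*\in E^*,\ \sup_{x\in B_E}\sum_{i=1}^n|x_i^*(x)|\le 1\}\in[0,\infty]$. Let $H_0[E]$ be the Banach lattice of all positively homogeneous $f$ with $\|f\|_{FBL[E]}<\infty$, with this norm and the pointwise order. $FBL[E]$ is the (closed) sublattice of $H_0[E]$ generated by $\{\delta_E(x):x\in E\}$, where $\delta_E(x)(x^* ):=x^*(x)$. The map $\delta_E:E\to FBL[E]$ is a linear isometry, and for every Banach lattice $X$ and bounded linear $T:E\to X$ there is a unique lattice homomorphism $\hat T:FBL[E]\to X$ with $\hat T\circ\delta_E=T$;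 moreover $\|\hat T\|=\|T\|$. For a Banach lattice $X$, $\beta_X:FBL[X]\to X$ is the unique lattice homomorphism with $\beta_X\circ\delta_X=id_X$. A Banach lattice $X$ has the lattice-lifting property if there is a lattice homomorphism $T:X\to FBL[X]$ with $\beta_X\circ T=id_X$. A subspace $A$ of a topological space $T$ is a retract of $T$ if there is a continuous map $T\to A$ which is the identity on $A$; it is a neighborhood retract of $T$ if there is an open set $U\subseteq T$ containing $A$ such that $A$ is a retract of $U$. A compact Hausdorff space is an absolute neighborhood retract (ANR) if it is a neighborhood retract of any compact Hausdorff space containing it. *)

theory Defs
  imports "HOL-Analysis.Analysis" "HOL-Library.Function_Algebras"
begin

text \<open>
  The Banach lattices needed here, \<open>C(K)\<close> and \<open>FBL[E]\<close>, live on function spaces that depend on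
  terms (a topology, a norm) and so are not types. A Banach lattice is therefore given by a linear
  sublattice \<open>V\<close> of an ambient vector lattice type, together with a norm \<open>N\<close> that matters only
  on \<open>V\<close>. For function types the ambient vector lattice structure is the pointwise one.
\<close>

instantiation "fun" :: (type, real_vector) real_vector
begin

definition scaleR_fun :: "real \<Rightarrow> ('a \<Rightarrow> 'b) \<Rightarrow> 'a \<Rightarrow> 'b"
  where "scaleR_fun c f = (\<lambda>x. c *\<^sub>R f x)"

instance
  by standard (simp_all add: scaleR_fun_def fun_eq_iff algebra_simps)

end

lemma scaleR_fun_apply [simp]: "(c *\<^sub>R f) x = c *\<^sub>R f x"
  by (simp add: scaleR_fun_def)

instance "fun" :: (type, ordered_real_vector) ordered_real_vector
  by standard (auto simp: le_fun_def intro: scaleR_left_mono scaleR_right_mono)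


section \<open>Banach lattices\<close>

definition sublattice :: "'x::{ordered_real_vector,lattice} set \<Rightarrow> bool"
  where "sublattice V \<longleftrightarrow> subspace V \<and> (\<forall>x\<in>V. \<forall>y\<in>V. sup x y \<in> V \<and> inf x y \<in> V)"

definition banach_lattice :: "'x::{ordered_real_vector,lattice} set \<Rightarrow> ('x \<Rightarrow> real) \<Rightarrow> bool"
  where "banach_lattice V N \<longleftrightarrow>
    sublattice V \<and>
    (\<forall>x\<in>V. 0 \<le> N x \<and> (N x = 0 \<longleftrightarrow> x = 0)) \<and>
    (\<forall>x\<in>V. \<forall>c. N (c *\<^sub>R x) = \<bar>c\<bar> * N x) \<and>
    (\<forall>x\<in>V. \<forall>y\<in>V. N (x + y) \<le> N x + N y) \<and>
    (\<forall>x\<in>V. \<forall>y\<in>V. sup x (- x) \<le> sup y (- y) \<longrightarrow> N x \<le> N y) \<and>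
    (\<forall>s. (\<forall>n. s n \<in> V) \<and> (\<forall>e>0. \<exists>M. \<forall>m\<ge>M. \<forall>n\<ge>M. N (s m - s n) < e) \<longrightarrow>
         (\<exists>x\<in>V. (\<lambda>n. N (s n - x)) \<longlonglongrightarrow> 0))"

definition closed_sublattice ::
    "'x::{ordered_real_vector,lattice} set \<Rightarrow> ('x \<Rightarrow> real) \<Rightarrow> 'x set \<Rightarrow> bool"
  where "closed_sublattice V N S \<longleftrightarrow>
    S \<subseteq> V \<and> sublattice S \<and>
    (\<forall>x\<in>V. (\<forall>e>0. \<exists>y\<in>S. N (x - y) < e) \<longrightarrow> x \<in> S)"

definition lattice_homomorphism ::
    "'x::{ordered_real_vector,lattice} set \<Rightarrow> ('x \<Rightarrow> real) \<Rightarrow>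
     'y::{ordered_real_vector,lattice} set \<Rightarrow> ('y \<Rightarrow> real) \<Rightarrow> ('x \<Rightarrow> 'y) \<Rightarrow> bool"
  where "lattice_homomorphism V N W M T \<longleftrightarrow>
    T ` V \<subseteq> W \<and>
    (\<forall>x\<in>V. \<forall>y\<in>V. T (x + y) = T x + T y) \<and>
    (\<forall>x\<in>V. \<forall>c. T (c *\<^sub>R x) = c *\<^sub>R T x) \<and>
    (\<exists>C. \<forall>x\<in>V. M (T x) \<le> C * N x) \<and>
    (\<forall>x\<in>V. \<forall>y\<in>V. T (sup x y) = sup (T x) (T y) \<and> T (inf x y) = inf (T x) (T y))"


section \<open>Dual space and weak-star topology\<close>

text \<open>Functionals on \<open>V\<close> are represented by functions on the ambient type that vanish off \<open>V\<close>.\<close>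

definition dual_space :: "'x::real_vector set \<Rightarrow> ('x \<Rightarrow> real) \<Rightarrow> ('x \<Rightarrow> real) set"
  where "dual_space V N = {\<phi>.
    (\<forall>x\<in>V. \<forall>y\<in>V. \<phi> (x + y) = \<phi> x + \<phi> y) \<and>
    (\<forall>x\<in>V. \<forall>c. \<phi> (c *\<^sub>R x) = c * \<phi> x) \<and>
    (\<exists>C. \<forall>x\<in>V. \<bar>\<phi> x\<bar> \<le> C * N x) \<and>
    (\<forall>x. x \<notin> V \<longrightarrow> \<phi> x = 0)}"

definition dual_ball :: "'x::real_vector set \<Rightarrow> ('x \<Rightarrow> real) \<Rightarrow> ('x \<Rightarrow> real) set"
  where "dual_ball V N = {\<phi> \<in> dual_space V N. \<forall>x\<in>V. N x \<le> 1 \<longrightarrow> \<bar>\<phi> x\<bar> \<le> 1}"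

text \<open>
  The topology of pointwise convergence on the whole ambient type; since the coordinates outside
  \<open>V\<close> are constantly 0, this is pointwise convergence on \<open>V\<close>.
\<close>

definition weak_star_dual_ball :: "'x::real_vector set \<Rightarrow> ('x \<Rightarrow> real) \<Rightarrow> ('x \<Rightarrow> real) topology"
  where "weak_star_dual_ball V N = subtopology (powertop_real UNIV) (dual_ball V N)"


section \<open>Free Banach lattices\<close>

definition fbl_norm ::
    "'x::real_vector set \<Rightarrow> ('x \<Rightarrow> real) \<Rightarrow> (('x \<Rightarrow> real) \<Rightarrow> real) \<Rightarrow> ennreal"
  where "fbl_norm V N f =
    (SUP (n, \<phi>) \<in> {(n :: nat, \<phi> :: nat \<Rightarrow> 'x \<Rightarrow> real).
        (\<forall>i<n. \<phi> i \<in> dual_space V N) \<and>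
        (\<forall>x\<in>V. N x \<le> 1 \<longrightarrow> (\<Sum>i<n. \<bar>\<phi> i x\<bar>) \<le> 1)}.
      ennreal (\<Sum>i<n. \<bar>f (\<phi> i)\<bar>))"

text \<open>
  A function on the dual space is represented by its extension by 0; this makes the ambient
  pointwise vector lattice operations the correct ones.
\<close>

definition H0 :: "'x::real_vector set \<Rightarrow> ('x \<Rightarrow> real) \<Rightarrow> (('x \<Rightarrow> real) \<Rightarrow> real) set"
  where "H0 V N = {f.
    (\<forall>\<phi> \<in> dual_space V N. \<forall>c>0. f (c *\<^sub>R \<phi>) = c * f \<phi>) \<and>
    (\<forall>\<phi>. \<phi> \<notin> dual_space V N \<longrightarrow> f \<phi> = 0) \<and>
    fbl_norm V N f < \<infinity>}"

definition H0_norm :: "'x::real_vector set \<Rightarrow> ('x \<Rightarrow> real) \<Rightarrow> (('x \<Rightarrow> real) \<Rightarrow> real) \<Rightarrow> real"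
  where "H0_norm V N f = enn2real (fbl_norm V N f)"

definition fbl_delta :: "'x::real_vector set \<Rightarrow> ('x \<Rightarrow> real) \<Rightarrow> 'x \<Rightarrow> ('x \<Rightarrow> real) \<Rightarrow> real"
  where "fbl_delta V N x = (\<lambda>\<phi>. if \<phi> \<in> dual_space V N then \<phi> x else 0)"

definition FBL :: "'x::real_vector set \<Rightarrow> ('x \<Rightarrow> real) \<Rightarrow> (('x \<Rightarrow> real) \<Rightarrow> real) set"
  where "FBL V N =
    \<Inter>{S. closed_sublattice (H0 V N) (H0_norm V N) S \<and> fbl_delta V N ` V \<subseteq> S}"

text \<open>The condition off \<open>FBL V N\<close> only serves to make the total function unique.\<close>

definition fbl_beta ::
    "'x::{ordered_real_vector,lattice} set \<Rightarrow> ('x \<Rightarrow> real) \<Rightarrow> (('x \<Rightarrow> real) \<Rightarrow> real) \<Rightarrow> 'x"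
  where "fbl_beta V N = (THE b.
    lattice_homomorphism (FBL V N) (H0_norm V N) V N b \<and>
    (\<forall>x\<in>V. b (fbl_delta V N x) = x) \<and>
    (\<forall>f. f \<notin> FBL V N \<longrightarrow> b f = 0))"

definition lattice_lifting_property ::
    "'x::{ordered_real_vector,lattice} set \<Rightarrow> ('x \<Rightarrow> real) \<Rightarrow> bool"
  where "lattice_lifting_property V N \<longleftrightarrow>
    (\<exists>T. lattice_homomorphism V N (FBL V N) (H0_norm V N) T \<and> (\<forall>x\<in>V. fbl_beta V N (T x) = x))"


section \<open>The Banach lattice of continuous functions\<close>

definition cont_funs :: "'a topology \<Rightarrow> ('a \<Rightarrow> real) set"
  where "cont_funs K = {h. continuous_map K euclideanreal h \<and> (\<forall>t. t \<notin> topspace K \<longrightarrow> h t = 0)}"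

text \<open>Inserting 0 only matters for the empty space, where the supremum should be 0.\<close>

definition sup_norm :: "'a topology \<Rightarrow> ('a \<Rightarrow> real) \<Rightarrow> real"
  where "sup_norm K h = Sup (insert 0 ((\<lambda>t. \<bar>h t\<bar>) ` topspace K))"

definition evaluation :: "'a topology \<Rightarrow> 'a \<Rightarrow> ('a \<Rightarrow> real) \<Rightarrow> real"
  where "evaluation K t = (\<lambda>h. if h \<in> cont_funs K then h t else 0)"


section \<open>Neighborhood retracts\<close>

definition neighborhood_retract_of :: "'a set \<Rightarrow> 'a topology \<Rightarrow> bool"
  where "neighborhood_retract_of A X \<longleftrightarrow>
    (\<exists>U. openin X U \<and> A \<subseteq> U \<and> A retract_of_space (subtopology X U))"

text \<open>
  A definition cannot quantify over all types, so the points of the containing spaces are taken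
  from a type \<open>'b\<close> given as a parameter; a theorem in which \<open>'b\<close> is arbitrary covers all compact
  Hausdorff spaces. The library's \<open>ANR\<close> is the notion for subsets of Euclidean spaces.
\<close>

definition compact_ANR :: "'b itself \<Rightarrow> 'a topology \<Rightarrow> bool"
  where "compact_ANR TYPE('b) K \<longleftrightarrow>
    compact_space K \<and> Hausdorff_space K \<and>
    (\<forall>(Y :: 'b topology) A.
      compact_space Y \<and> Hausdorff_space Y \<and> A \<subseteq> topspace Y \<and>
      subtopology Y A homeomorphic_space K \<longrightarrow> neighborhood_retract_of A Y)"


section \<open>Consistency of the encoding\<close>

text \<open>
  \<open>C(K)\<close> is a Banach lattice, \<open>FBL\<close> is a closed sublattice of \<open>H0\<close>, and the map described in
  \<open>fbl_beta\<close> is unique and, for \<open>C(K)\<close>, exists: it is evaluation at the point evaluations.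
\<close>

lemma fbl_norm_le_comb:
  assumes "\<And>\<phi>. \<bar>h \<phi>\<bar> \<le> a * \<bar>f \<phi>\<bar> + b * \<bar>g \<phi>\<bar>" "a \<ge> 0" "b \<ge> 0"
  shows "fbl_norm V N h \<le> ennreal a * fbl_norm V N f + ennreal b * fbl_norm V N g"
  unfolding fbl_norm_def[of _ _ h]
proof (rule SUP_least, clarsimp)
  fix n and \<phi> :: "nat \<Rightarrow> 'a \<Rightarrow> real"
  assume *: "\<forall>i<n. \<phi> i \<in> dual_space V N" "\<forall>x\<in>V. N x \<le> 1 \<longrightarrow> (\<Sum>i<n. \<bar>\<phi> i x\<bar>) \<le> 1"
  have le: "ennreal (\<Sum>i<n. \<bar>k (\<phi> i)\<bar>) \<le> fbl_norm V N k" for k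
    unfolding fbl_norm_def by (rule SUP_upper2[of "(n, \<phi>)"]) (use * in auto)
  have "(\<Sum>i<n. \<bar>h (\<phi> i)\<bar>) \<le> (\<Sum>i<n. a * \<bar>f (\<phi> i)\<bar> + b * \<bar>g (\<phi> i)\<bar>)"
    by (rule sum_mono) (rule assms)
  also have "\<dots> = a * (\<Sum>i<n. \<bar>f (\<phi> i)\<bar>) + b * (\<Sum>i<n. \<bar>g (\<phi> i)\<bar>)"
    by (simp add: sum.distrib sum_distrib_left)
  finally have "ennreal (\<Sum>i<n. \<bar>h (\<phi> i)\<bar>) \<le>
      ennreal (a * (\<Sum>i<n. \<bar>f (\<phi> i)\<bar>) + b * (\<Sum>i<n. \<bar>g (\<phi> i)\<bar>))"
    by (rule ennreal_leI)
  also have "\<dots> = ennreal a * ennreal (\<Sum>i<n. \<bar>f (\<phi> i)\<bar>) + ennreal b * ennreal (\<Sum>i<n. \<bar>g (\<phi> i)\<bar>)"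
    using assms by (simp add: ennreal_plus ennreal_mult sum_nonneg)
  also have "\<dots> \<le> ennreal a * fbl_norm V N f + ennreal b * fbl_norm V N g"
    by (intro add_mono mult_left_mono le) auto
  finally show "ennreal (\<Sum>i<n. \<bar>h (\<phi> i)\<bar>) \<le> ennreal a * fbl_norm V N f + ennreal b * fbl_norm V N g" .
qed

lemma fbl_norm_finite_comb:
  assumes "\<And>\<phi>. \<bar>h \<phi>\<bar> \<le> a * \<bar>f \<phi>\<bar> + b * \<bar>g \<phi>\<bar>" "a \<ge> 0" "b \<ge> 0"
    "fbl_norm V N f < top" "fbl_norm V N g < top"
  shows "fbl_norm V N h < top"
  by (rule le_less_trans[OF fbl_norm_le_comb[OF assms(1-3)]])
    (use assms in \<open>auto simp: ennreal_mult_less_top\<close>)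

lemma sublattice_H0:
  assumes "subspace V"
  shows "sublattice (H0 V N)"
proof -
  have 0: "fbl_norm V N 0 = 0" unfolding fbl_norm_def by (auto simp: SUP_constant bot_ennreal)
  have add: "f + g \<in> H0 V N" and sup: "sup f g \<in> H0 V N" and inf: "inf f g \<in> H0 V N"
    if "f \<in> H0 V N" "g \<in> H0 V N" for f g
  proof -
    have [simp]: "fbl_norm V N f < top" "fbl_norm V N g < top" using that by (auto simp: H0_def)
    have "fbl_norm V N (f + g) < top" 
      by (rule fbl_norm_finite_comb[of _ 1 f 1 g]) auto
    then show "f + g \<in> H0 V N" using that by (auto simp: H0_def algebra_simps)
    have "fbl_norm V N (sup f g) < top" 
      by (rule fbl_norm_finite_comb[of _ 1 f 1 g]) (auto simp: sup_real_def)
    then show "sup f g \<in> H0 V N" using that by (auto simp: H0_def sup_real_def max_mult_distrib_left)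
    have "fbl_norm V N (inf f g) < top" 
      by (rule fbl_norm_finite_comb[of _ 1 f 1 g]) (auto simp: inf_real_def)
    then show "inf f g \<in> H0 V N" using that by (auto simp: H0_def inf_real_def min_mult_distrib_left)
  qed
  have "c *\<^sub>R f \<in> H0 V N" if "f \<in> H0 V N" for f c
  proof -
    have "fbl_norm V N (c *\<^sub>R f) < top" 
      by (rule fbl_norm_finite_comb[of _ "\<bar>c\<bar>" f 0 f]) (use that in \<open>auto simp: abs_mult H0_def\<close>)
    then show ?thesis using that by (auto simp: H0_def)
  qed
  moreover have "0 \<in> H0 V N" by (auto simp: H0_def 0)
  ultimately show ?thesis unfolding sublattice_def subspace_def using add sup inf by auto
qed


lemma fbl_delta_in_H0:
  assumes V: "banach_lattice V N" and x: "x \<in> V"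
  shows "fbl_delta V N x \<in> H0 V N"
proof -
  have "fbl_norm V N (fbl_delta V N x) \<le> ennreal (N x)"
    unfolding fbl_norm_def
  proof (rule SUP_least, clarsimp)
    fix n and \<phi> :: "nat \<Rightarrow> 'a \<Rightarrow> real"
    assume *: "\<forall>i<n. \<phi> i \<in> dual_space V N" "\<forall>x\<in>V. N x \<le> 1 \<longrightarrow> (\<Sum>i<n. \<bar>\<phi> i x\<bar>) \<le> 1"
    have "(\<Sum>i<n. \<bar>\<phi> i x\<bar>) \<le> N x"
    proof (cases "x = 0")
      case True
      have "\<phi> i 0 = 0" if "i < n" for i
        using * that x True unfolding dual_space_def by (auto dest!: spec[of _ i] bspec[of V _ 0] spec[of _ "0::real"])
      then show ?thesis using True V x by (auto simp: banach_lattice_def)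
    next
      case False
      let ?r = "inverse (N x)"
      have r: "N x > 0" using V x False by (auto simp: banach_lattice_def less_le)
      have m: "?r *\<^sub>R x \<in> V" using V x by (auto simp: banach_lattice_def sublattice_def subspace_scale)
      have "N (?r *\<^sub>R x) = \<bar>?r\<bar> * N x" using V x unfolding banach_lattice_def by blast
      then have "N (?r *\<^sub>R x) = 1" using r by simp
      then have "(\<Sum>i<n. \<bar>\<phi> i (?r *\<^sub>R x)\<bar>) \<le> 1" using * m by simp
      moreover have "(\<Sum>i<n. \<bar>\<phi> i (?r *\<^sub>R x)\<bar>) = (\<Sum>i<n. ?r * \<bar>\<phi> i x\<bar>)"
        using *(1) x r by (intro sum.cong) (auto simp: dual_space_def abs_mult)
      ultimately have "?r * (\<Sum>i<n. \<bar>\<phi> i x\<bar>) \<le> 1" by (simp add: sum_distrib_left)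
      then show ?thesis using r by (simp add: field_simps)
    qed
    moreover have "(\<Sum>i<n. \<bar>fbl_delta V N x (\<phi> i)\<bar>) = (\<Sum>i<n. \<bar>\<phi> i x\<bar>)"
      using * by (intro sum.cong) (auto simp: fbl_delta_def)
    ultimately show "ennreal (\<Sum>i<n. \<bar>fbl_delta V N x (\<phi> i)\<bar>) \<le> ennreal (N x)"
      by (simp add: ennreal_leI)
  qed
  then have "fbl_norm V N (fbl_delta V N x) < top" by (rule le_less_trans) simp
  moreover have "c *\<^sub>R \<phi> \<in> dual_space V N" if "\<phi> \<in> dual_space V N" for c \<phi>
  proof -
    from that obtain C where "\<forall>x\<in>V. \<bar>\<phi> x\<bar> \<le> C * N x" by (auto simp: dual_space_def)
    then have "\<forall>x\<in>V. \<bar>(c *\<^sub>R \<phi>) x\<bar> \<le> (\<bar>c\<bar> * C) * N x"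
      by (auto simp: abs_mult mult.assoc intro: mult_left_mono)
    then have "\<exists>C. \<forall>x\<in>V. \<bar>(c *\<^sub>R \<phi>) x\<bar> \<le> C * N x" by blast
    then show ?thesis using that by (simp add: dual_space_def distrib_left mult.left_commute)
  qed
  ultimately show ?thesis by (auto simp: H0_def fbl_delta_def)
qed

lemma closed_sublattice_H0:
  "subspace V \<Longrightarrow> closed_sublattice (H0 V N) (H0_norm V N) (H0 V N)"
  by (simp add: closed_sublattice_def sublattice_H0)

lemma FBL_least:
  "closed_sublattice (H0 V N) (H0_norm V N) S \<Longrightarrow> fbl_delta V N ` V \<subseteq> S \<Longrightarrow> FBL V N \<subseteq> S"
  by (auto simp: FBL_def)

lemma fbl_delta_in_FBL: "x \<in> V \<Longrightarrow> fbl_delta V N x \<in> FBL V N"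
  by (auto simp: FBL_def)

lemma closed_sublattice_FBL:
  assumes V: "banach_lattice V N"
  shows "closed_sublattice (H0 V N) (H0_norm V N) (FBL V N)"
proof -
  let ?F = "{S. closed_sublattice (H0 V N) (H0_norm V N) S \<and> fbl_delta V N ` V \<subseteq> S}"
  have "subspace V" using V by (simp add: banach_lattice_def sublattice_def)
  then have H: "H0 V N \<in> ?F" using closed_sublattice_H0 fbl_delta_in_H0[OF V] by auto
  then have subH: "\<Inter>?F \<subseteq> H0 V N" by (rule Inter_lower)
  have sub: "subspace (\<Inter>?F)"
    by (rule subspace_Inter) (auto simp: closed_sublattice_def sublattice_def)
  have lat: "sup x y \<in> \<Inter>?F \<and> inf x y \<in> \<Inter>?F" if "x \<in> \<Inter>?F" "y \<in> \<Inter>?F" for x y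
  proof -
    have "sup x y \<in> S \<and> inf x y \<in> S" if "S \<in> ?F" for S
    proof -
      have "x \<in> S" "y \<in> S" using \<open>x \<in> \<Inter>?F\<close> \<open>y \<in> \<Inter>?F\<close> that by fast+
      then show ?thesis using that by (simp add: closed_sublattice_def sublattice_def)
    qed
    then show ?thesis by fast
  qed
  have cl: "x \<in> \<Inter>?F" if "x \<in> H0 V N" "\<forall>e>0. \<exists>y\<in>\<Inter>?F. H0_norm V N (x - y) < e" for x
  proof
    fix S assume S: "S \<in> ?F"
    then have "\<forall>e>0. \<exists>y\<in>S. H0_norm V N (x - y) < e" using that(2) by fast
    then show "x \<in> S" using S that(1) by (simp add: closed_sublattice_def)
  qed
  show ?thesis
    unfolding FBL_def
  proof (subst closed_sublattice_def, subst sublattice_def, intro conjI ballI impI)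
    fix x y assume "x \<in> \<Inter>?F" "y \<in> \<Inter>?F"
    then show "sup x y \<in> \<Inter>?F" "inf x y \<in> \<Inter>?F" using lat by blast+
  qed (fact subH, fact sub, fact cl)
qed

lemma fbl_beta_unique:
  assumes V: "banach_lattice V N"
    and b: "lattice_homomorphism (FBL V N) (H0_norm V N) V N b" "\<And>x. x \<in> V \<Longrightarrow> b (fbl_delta V N x) = x"
    and c: "lattice_homomorphism (FBL V N) (H0_norm V N) V N c" "\<And>x. x \<in> V \<Longrightarrow> c (fbl_delta V N x) = x"
    and f: "f \<in> FBL V N"
  shows "b f = c f"
proof -
  let ?S = "{f \<in> FBL V N. b f = c f}"
  have F: "closed_sublattice (H0 V N) (H0_norm V N) (FBL V N)" by (rule closed_sublattice_FBL[OF V])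
  then have sF: "subspace (FBL V N)" and lF: "\<And>x y. x \<in> FBL V N \<Longrightarrow> y \<in> FBL V N \<Longrightarrow> sup x y \<in> FBL V N \<and> inf x y \<in> FBL V N"
    and FH: "FBL V N \<subseteq> H0 V N"
    by (simp_all add: closed_sublattice_def sublattice_def)
  have sV: "subspace V" using V by (simp add: banach_lattice_def sublattice_def)
  have tri: "N (x + y) \<le> N x + N y" if "x \<in> V" "y \<in> V" for x y
    using V that by (simp add: banach_lattice_def)
  have nz: "x = 0" if "x \<in> V" "N x \<le> 0" for x
    using V that unfolding banach_lattice_def by (meson order_antisym)
  have nsc: "N (r *\<^sub>R x) = \<bar>r\<bar> * N x" if "x \<in> V" for x r
    using V that unfolding banach_lattice_def by blast
  have badd: "b (x + y) = b x + b y" "c (x + y) = c x + c y" if "x \<in> FBL V N" "y \<in> FBL V N" for x y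
    using b c that by (auto simp: lattice_homomorphism_def)
  have bsc: "b (r *\<^sub>R x) = r *\<^sub>R b x" "c (r *\<^sub>R x) = r *\<^sub>R c x" if "x \<in> FBL V N" for x r
    using b c that by (auto simp: lattice_homomorphism_def)
  have bV: "b x \<in> V" "c x \<in> V" if "x \<in> FBL V N" for x
    using b c that by (auto simp: lattice_homomorphism_def)
  have b0: "b 0 = c 0" using bsc[OF subspace_0[OF sF], of 0] by simp
  have bl: "b (sup x y) = sup (b x) (b y)" "c (sup x y) = sup (c x) (c y)"
    "b (inf x y) = inf (b x) (b y)" "c (inf x y) = inf (c x) (c y)"
    if "x \<in> FBL V N" "y \<in> FBL V N" for x y
    using b(1) c(1) that unfolding lattice_homomorphism_def by simp_all
  have "subspace ?S"
    using sF b0 badd bsc by (simp add: subspace_def)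
  moreover have "\<forall>x\<in>?S. \<forall>y\<in>?S. sup x y \<in> ?S \<and> inf x y \<in> ?S"
    using lF bl by simp
  ultimately have latS: "sublattice ?S" unfolding sublattice_def by blast
  have clS: "f \<in> ?S" if fH: "f \<in> H0 V N" and ap: "\<forall>e>0. \<exists>y\<in>?S. H0_norm V N (f - y) < e" for f
  proof -
    have "\<forall>e>0. \<exists>y\<in>FBL V N. H0_norm V N (f - y) < e" using ap by fast
    then have fF: "f \<in> FBL V N" using F fH by (simp add: closed_sublattice_def)
    obtain B where B: "\<And>x. x \<in> FBL V N \<Longrightarrow> N (b x) \<le> B * H0_norm V N x"
      using b(1) unfolding lattice_homomorphism_def by blast
    obtain C where C: "\<And>x. x \<in> FBL V N \<Longrightarrow> N (c x) \<le> C * H0_norm V N x"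
      using c(1) unfolding lattice_homomorphism_def by blast
    let ?D = "\<bar>B\<bar> + \<bar>C\<bar> + 1"
    have diff: "b f - c f \<in> V" using bV fF sV by (simp add: subspace_diff)
    have "N (b f - c f) \<le> 0 + e" if e: "e > 0" for e
    proof -
      obtain y where y: "y \<in> ?S" "H0_norm V N (f - y) < e / ?D"
        proof -
        have "e / ?D > 0" using e by (intro divide_pos_pos) simp_all
        with ap show ?thesis using that by blast
      qed
      let ?d = "f - y"
      have d: "?d \<in> FBL V N" using fF y sF by (simp add: subspace_diff)
      have *: "b f = b ?d + b y" "c f = c ?d + c y" using badd[OF d, of y] y by auto
      have "b f - c f = b ?d + (-1) *\<^sub>R c ?d" using * y by simp
      then have "N (b f - c f) \<le> N (b ?d) + N ((-1) *\<^sub>R c ?d)"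
        using tri[OF bV(1)[OF d] subspace_scale[OF sV bV(2)[OF d]]] by metis
      also have "N ((-1) *\<^sub>R c ?d) = N (c ?d)" using nsc[OF bV(2)[OF d], of "-1"] by simp
      also have "N (b ?d) + N (c ?d) \<le> B * H0_norm V N ?d + C * H0_norm V N ?d"
        by (intro add_mono B C d)
      also have "\<dots> \<le> ?D * H0_norm V N ?d"
        unfolding distrib_right[symmetric] by (rule mult_right_mono) (auto simp: H0_norm_def)
      also have "\<dots> \<le> ?D * (e / ?D)" using y by (intro mult_left_mono) auto
      also have "\<dots> = e" by simp
      finally show ?thesis by simp
    qed
    then have "N (b f - c f) \<le> 0" by (rule field_le_epsilon)
    then have "b f - c f = 0" using nz[OF diff] by blast
    then show ?thesis using fF by simp
  qed
  have "?S \<subseteq> H0 V N" using FH by blast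
  then have "closed_sublattice (H0 V N) (H0_norm V N) ?S"
    unfolding closed_sublattice_def by (intro conjI ballI impI latS clS)
  moreover have "fbl_delta V N ` V \<subseteq> ?S" using b(2) c(2) fbl_delta_in_FBL[of _ V N] by force
  ultimately have "FBL V N \<subseteq> ?S" by (rule FBL_least)
  then show ?thesis using f by auto
qed

lemma fbl_beta_eqI:
  assumes V: "banach_lattice V N"
    and b: "lattice_homomorphism (FBL V N) (H0_norm V N) V N b" "\<And>x. x \<in> V \<Longrightarrow> b (fbl_delta V N x) = x"
      "\<And>f. f \<notin> FBL V N \<Longrightarrow> b f = 0"
  shows "fbl_beta V N = b"
  unfolding fbl_beta_def
proof (rule the_equality)
  show "b' = b" if "lattice_homomorphism (FBL V N) (H0_norm V N) V N b' \<and>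
    (\<forall>x\<in>V. b' (fbl_delta V N x) = x) \<and> (\<forall>f. f \<notin> FBL V N \<longrightarrow> b' f = 0)" for b'
  proof
    fix f
    show "b' f = b f"
    proof (cases "f \<in> FBL V N")
      case True
      show ?thesis by (rule fbl_beta_unique[OF V _ _ b(1,2) True]) (use that in blast)+
    next
      case False
      then show ?thesis using that b(3) by simp
    qed
  qed
qed (use b in auto)

lemma abs_le_sup_norm:
  assumes "compact_space K" "h \<in> cont_funs K"
  shows "\<bar>h t\<bar> \<le> sup_norm K h"
proof (cases "t \<in> topspace K")
  case True
  have c: "continuous_map K euclideanreal (\<lambda>t. \<bar>h t\<bar>)"
    using assms(2) by (auto simp: cont_funs_def intro: continuous_intros)
  have "compact ((\<lambda>t. \<bar>h t\<bar>) ` topspace K)"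
    using image_compactin[OF _ c] assms(1) by (simp add: compact_space_def)
  then have "bdd_above (insert 0 ((\<lambda>t. \<bar>h t\<bar>) ` topspace K))"
    by (simp add: bounded_imp_bdd_above compact_imp_bounded)
  then show ?thesis unfolding sup_norm_def using True by (intro cSup_upper) auto
next
  case False
  have c: "continuous_map K euclideanreal (\<lambda>t. \<bar>h t\<bar>)"
    using assms(2) by (auto simp: cont_funs_def intro: continuous_intros)
  have "compact ((\<lambda>t. \<bar>h t\<bar>) ` topspace K)"
    using image_compactin[OF _ c] assms(1) by (simp add: compact_space_def)
  then have "bdd_above (insert 0 ((\<lambda>t. \<bar>h t\<bar>) ` topspace K))"
    by (simp add: bounded_imp_bdd_above compact_imp_bounded)
  then have "0 \<le> sup_norm K h" unfolding sup_norm_def by (intro cSup_upper) auto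
  then show ?thesis using assms False by (simp add: cont_funs_def)
qed

lemma sup_norm_le: "0 \<le> c \<Longrightarrow> (\<And>t. t \<in> topspace K \<Longrightarrow> \<bar>h t\<bar> \<le> c) \<Longrightarrow> sup_norm K h \<le> c"
  unfolding sup_norm_def by (rule cSup_least) auto

lemma sublattice_cont_funs: "sublattice (cont_funs K)"
  unfolding sublattice_def subspace_def
  by (auto simp: cont_funs_def plus_fun_def zero_fun_def scaleR_fun_def sup_fun_def inf_fun_def
     sup_max inf_min intro!: continuous_intros continuous_map_real_mult_left)

lemma banach_lattice_cont_funs:
  assumes K: "compact_space K"
  shows "banach_lattice (cont_funs K) (sup_norm K)"
proof -
  have S: "subspace (cont_funs K)" using sublattice_cont_funs by (auto simp: sublattice_def)
  note ub = abs_le_sup_norm[OF K]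
  have nn: "0 \<le> sup_norm K x" if "x \<in> cont_funs K" for x using ub[OF that] by (meson abs_ge_zero order_trans)
  have "x = 0" if "x \<in> cont_funs K" "sup_norm K x = 0" for x using ub[OF that(1)] that by (auto simp: fun_eq_iff)
  then have defin: "\<forall>x\<in>cont_funs K. 0 \<le> sup_norm K x \<and> (sup_norm K x = 0 \<longleftrightarrow> x = 0)" if "sup_norm K 0 = 0"
    using nn that by blast
  have zero: "sup_norm K 0 = 0"
    using sup_norm_le[of 0 K 0] nn[OF subspace_0[OF S]] by auto
  have tri: "sup_norm K (x + y) \<le> sup_norm K x + sup_norm K y"
    if "x \<in> cont_funs K" "y \<in> cont_funs K" for x y
  proof (rule sup_norm_le)
    show "\<bar>(x + y) t\<bar> \<le> sup_norm K x + sup_norm K y" for t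
      using ub[OF that(1), of t] ub[OF that(2), of t] abs_triangle_ineq[of "x t" "y t"] by simp
  qed (use nn that in simp)
  have sc: "sup_norm K (c *\<^sub>R x) \<le> \<bar>c\<bar> * sup_norm K x" if "x \<in> cont_funs K" for x c
    using that nn ub by (intro sup_norm_le) (auto simp: abs_mult intro: mult_left_mono)
  have sc2: "sup_norm K (c *\<^sub>R x) \<ge> \<bar>c\<bar> * sup_norm K x" if x: "x \<in> cont_funs K" for x c
  proof (cases "c = 0")
    case True then show ?thesis using nn[of "c *\<^sub>R x"] S x by (simp add: subspace_0)
  next
    case False
    have "sup_norm K (inverse c *\<^sub>R (c *\<^sub>R x)) \<le> \<bar>inverse c\<bar> * sup_norm K (c *\<^sub>R x)"
      by (rule sc) (use S x in \<open>simp add: subspace_scale\<close>)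
    then show ?thesis using False by (simp add: field_simps)
  qed
  have mon: "sup_norm K x \<le> sup_norm K y"
    if "x \<in> cont_funs K" "y \<in> cont_funs K" "sup x (- x) \<le> sup y (- y)" for x y
  proof (rule sup_norm_le)
    fix t 
    have "\<bar>x t\<bar> \<le> \<bar>y t\<bar>" using le_funD[OF that(3), of t] by (auto simp: sup_max)
    then show "\<bar>x t\<bar> \<le> sup_norm K y" using ub[OF that(2), of t] by simp
  qed (use nn that in auto)
  have comp: "\<exists>x\<in>cont_funs K. (\<lambda>n. sup_norm K (s n - x)) \<longlonglongrightarrow> 0"
    if s: "\<forall>n. s n \<in> cont_funs K" and C: "\<forall>e>0. \<exists>M. \<forall>m\<ge>M. \<forall>n\<ge>M. sup_norm K (s m - s n) < e" for s
  proof -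
    have d: "\<bar>s m t - s n t\<bar> \<le> sup_norm K (s m - s n)" for m n t
      using ub[of "s m - s n" t] s S by (simp add: subspace_diff)
    have "Cauchy (\<lambda>n. s n t)" for t
      unfolding Cauchy_def dist_real_def
    proof (intro allI impI)
      fix e :: real assume "e > 0"
      then obtain M where "\<forall>m\<ge>M. \<forall>n\<ge>M. sup_norm K (s m - s n) < e"
        using C \<open>e > 0\<close> by blast
      then show "\<exists>M. \<forall>m\<ge>M. \<forall>n\<ge>M. \<bar>s m t - s n t\<bar> < e"
        using d[THEN le_less_trans] by blast
    qed
    then obtain x where x: "\<And>t. (\<lambda>n. s n t) \<longlonglongrightarrow> x t"
      unfolding Cauchy_convergent_iff convergent_def by metis
    have u: "\<exists>M. \<forall>m\<ge>M. \<forall>t. \<bar>s m t - x t\<bar> \<le> e" if e: "e > 0" for e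
    proof -
      obtain M where M: "\<forall>m\<ge>M. \<forall>n\<ge>M. sup_norm K (s m - s n) < e" using C e by blast
      have "\<bar>s m t - x t\<bar> \<le> e" if "m \<ge> M" for m t
      proof (rule LIMSEQ_le_const2)
        show "(\<lambda>n. \<bar>s m t - s n t\<bar>) \<longlonglongrightarrow> \<bar>s m t - x t\<bar>" by (intro tendsto_intros x)
        show "\<exists>N. \<forall>n\<ge>N. \<bar>s m t - s n t\<bar> \<le> e" using M that d[THEN order_trans] less_imp_le by blast
      qed
      then show ?thesis by blast
    qed
    have "continuous_map K Met_TC.mtopology x"
    proof (rule Met_TC.continuous_map_uniform_limit)
      show "\<forall>\<^sub>F n in sequentially. continuous_map K Met_TC.mtopology (s n)"
        using s by (auto simp: cont_funs_def)
      show "\<forall>\<^sub>F n in sequentially. \<forall>t\<in>topspace K. x t \<in> UNIV \<and> dist (s n t) (x t) < e" if "e > 0" for e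
      proof -
        obtain M where M: "\<forall>m\<ge>M. \<forall>t. \<bar>s m t - x t\<bar> \<le> e/2" using u[of "e/2"] \<open>e > 0\<close> by auto
        have "dist (s m t) (x t) < e" if "m \<ge> M" for m t
        proof -
          have "\<bar>s m t - x t\<bar> \<le> e/2" using M that by blast
          then show ?thesis using \<open>e > 0\<close> by (simp add: dist_real_def)
        qed
        then show ?thesis unfolding eventually_sequentially by blast
      qed
    qed auto
    moreover have "x t = 0" if "t \<notin> topspace K" for t
      
    proof -
      have "s n t = 0" for n using s that by (simp add: cont_funs_def)
      then show ?thesis using x[of t] by (simp add: LIMSEQ_const_iff)
    qed
    ultimately have xm: "x \<in> cont_funs K" by (auto simp: cont_funs_def)
    have "(\<lambda>n. sup_norm K (s n - x)) \<longlonglongrightarrow> 0"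
    proof (rule LIMSEQ_I)
      fix r :: real assume "r > 0"
      then obtain M where M: "\<forall>m\<ge>M. \<forall>t. \<bar>s m t - x t\<bar> \<le> r/2" using u[of "r/2"] by auto
      have "norm (sup_norm K (s n - x) - 0) < r" if "n \<ge> M" for n
      proof -
        have "sup_norm K (s n - x) \<le> r/2" using M that \<open>r > 0\<close> by (intro sup_norm_le) auto
        moreover have "0 \<le> sup_norm K (s n - x)" using nn s xm S by (simp add: subspace_diff)
        ultimately show ?thesis using \<open>r > 0\<close> by simp
      qed
      then show "\<exists>M. \<forall>n\<ge>M. norm (sup_norm K (s n - x) - 0) < r" by blast
    qed
    with xm show ?thesis by blast
  qed
  have sc3: "sup_norm K (c *\<^sub>R x) = \<bar>c\<bar> * sup_norm K x" if "x \<in> cont_funs K" for x c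
    using sc[OF that] sc2[OF that] by (rule order_antisym)
  show ?thesis unfolding banach_lattice_def
  proof (intro conjI)
    show "\<forall>s. (\<forall>n. s n \<in> cont_funs K) \<and> (\<forall>e>0. \<exists>M. \<forall>m\<ge>M. \<forall>n\<ge>M. sup_norm K (s m - s n) < e) \<longrightarrow>
         (\<exists>x\<in>cont_funs K. (\<lambda>n. sup_norm K (s n - x)) \<longlonglongrightarrow> 0)"
      using comp by simp
  qed (use sublattice_cont_funs defin[OF zero] sc3 tri mon in blast)+
qed

lemma evaluation_in_dual_ball:
  assumes K: "compact_space K"
  shows "evaluation K t \<in> dual_ball (cont_funs K) (sup_norm K)"
proof -
  have S: "subspace (cont_funs K)" using sublattice_cont_funs by (auto simp: sublattice_def)
  have "\<bar>evaluation K t h\<bar> \<le> 1 * sup_norm K h" if "h \<in> cont_funs K" for h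
    using abs_le_sup_norm[OF K that, of t] that by (simp add: evaluation_def)
  then have "\<exists>C. \<forall>h\<in>cont_funs K. \<bar>evaluation K t h\<bar> \<le> C * sup_norm K h" by blast
  then have "evaluation K t \<in> dual_space (cont_funs K) (sup_norm K)"
    using S by (simp add: dual_space_def evaluation_def subspace_add subspace_scale)
  moreover have "\<bar>evaluation K t h\<bar> \<le> 1" if "h \<in> cont_funs K" "sup_norm K h \<le> 1" for h
    using abs_le_sup_norm[OF K that(1), of t] that by (simp add: evaluation_def)
  ultimately show ?thesis by (simp add: dual_ball_def)
qed

lemma abs_le_H0_norm:
  assumes "f \<in> H0 V N" "\<phi> \<in> dual_ball V N"
  shows "\<bar>f \<phi>\<bar> \<le> H0_norm V N f"
proof -
  have "ennreal (\<Sum>i<1::nat. \<bar>f \<phi>\<bar>) \<le> fbl_norm V N f"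
    unfolding fbl_norm_def by (rule SUP_upper2[of "(1, \<lambda>_. \<phi>)"]) (use assms in \<open>auto simp: dual_ball_def\<close>)
  moreover have "fbl_norm V N f < top" using assms by (auto simp: H0_def)
  ultimately show ?thesis unfolding H0_norm_def by (cases "fbl_norm V N f") simp_all
qed

lemma fbl_beta_cont_funs:
  assumes K: "compact_space K" and f: "f \<in> FBL (cont_funs K) (sup_norm K)"
  shows "fbl_beta (cont_funs K) (sup_norm K) f = (\<lambda>t. if t \<in> topspace K then f (evaluation K t) else 0)"
proof -
  let ?V = "cont_funs K" and ?N = "sup_norm K"
  let ?b = "\<lambda>f t. if t \<in> topspace K then f (evaluation K t) else 0 :: real"
  let ?S = "{f \<in> H0 ?V ?N. continuous_map K euclideanreal (\<lambda>t. f (evaluation K t))}"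
  note V = banach_lattice_cont_funs[OF K]
  have sV: "subspace ?V" using sublattice_cont_funs by (auto simp: sublattice_def)
  have sH: "sublattice (H0 ?V ?N)" by (rule sublattice_H0[OF sV])
  have b0: "evaluation K t \<in> dual_ball ?V ?N" for t by (rule evaluation_in_dual_ball[OF K])
  then have d0: "evaluation K t \<in> dual_space ?V ?N" for t by (auto simp: dual_ball_def)
  have latS: "sublattice ?S"
    using sH unfolding sublattice_def subspace_def
    by (simp add: sup_max inf_min continuous_map_add continuous_map_real_max continuous_map_real_min
        continuous_map_real_mult_left)
  have closedS: "f \<in> ?S" if f: "f \<in> H0 ?V ?N" and ap: "\<forall>e>0. \<exists>y\<in>?S. H0_norm ?V ?N (f - y) < e" for f
  proof -
    obtain y where y: "\<And>n::nat. y n \<in> ?S" "\<And>n. H0_norm ?V ?N (f - y n) < inverse (real (Suc n))"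
    proof -
      have "\<forall>n. \<exists>y. y \<in> ?S \<and> H0_norm ?V ?N (f - y) < inverse (real (Suc n))"
      proof
        fix n
        have "0 < inverse (real (Suc n))" by simp
        with ap show "\<exists>y. y \<in> ?S \<and> H0_norm ?V ?N (f - y) < inverse (real (Suc n))" by blast
      qed
      from choice[OF this] show ?thesis using that by blast
    qed
    have "continuous_map K Met_TC.mtopology (\<lambda>t. f (evaluation K t))"
    proof (rule Met_TC.continuous_map_uniform_limit)
      show "\<forall>\<^sub>F n in sequentially. continuous_map K Met_TC.mtopology (\<lambda>t. y n (evaluation K t))"
        using y by auto
      fix e :: real assume "e > 0"
      then obtain M where M: "inverse (real (Suc M)) < e" using reals_Archimedean by blast
      have "dist (y n (evaluation K t)) (f (evaluation K t)) < e" if "n \<ge> M" for n t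
      proof -
        have "y n \<in> H0 ?V ?N" using y(1)[of n] by simp
        then have "f - y n \<in> H0 ?V ?N" using sH f by (simp add: sublattice_def subspace_diff)
        then have "\<bar>(f - y n) (evaluation K t)\<bar> \<le> H0_norm ?V ?N (f - y n)" by (rule abs_le_H0_norm[OF _ b0])
        also have "\<dots> < inverse (real (Suc n))" by (rule y)
        also have "\<dots> \<le> inverse (real (Suc M))" using that by simp
        also note M
        finally show ?thesis by (simp add: dist_real_def abs_minus_commute del: of_nat_Suc)
      qed
      then show "\<forall>\<^sub>F n in sequentially. \<forall>t\<in>topspace K. f (evaluation K t) \<in> UNIV \<and> dist (y n (evaluation K t)) (f (evaluation K t)) < e"
        unfolding eventually_sequentially by blast
    qed auto
    with f show ?thesis by simp
  qed
  have "?S \<subseteq> H0 ?V ?N" by blast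
  then have clS: "closed_sublattice (H0 ?V ?N) (H0_norm ?V ?N) ?S"
    unfolding closed_sublattice_def by (intro conjI ballI impI latS closedS)
  have "fbl_delta ?V ?N h \<in> ?S" if h: "h \<in> ?V" for h
  proof -
    have "(\<lambda>t. fbl_delta ?V ?N h (evaluation K t)) = h"
      using h d0 by (auto simp: fbl_delta_def evaluation_def)
    then show ?thesis using h fbl_delta_in_H0[OF V h] by (simp add: cont_funs_def)
  qed
  then have "fbl_delta ?V ?N ` ?V \<subseteq> ?S" by (rule image_subsetI)
  then have FS: "FBL ?V ?N \<subseteq> ?S" by (rule FBL_least[OF clS])
  have m: "f \<in> H0 ?V ?N" "?b f \<in> ?V" if "f \<in> FBL ?V ?N" for f
  proof -
    have f: "f \<in> ?S" using FS that by (rule subsetD)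
    then show "f \<in> H0 ?V ?N" by simp
    have "continuous_map K euclideanreal (?b f)"
      by (rule continuous_map_eq[of _ _ "\<lambda>t. f (evaluation K t)"]) (use f in simp_all)
    then show "?b f \<in> ?V" by (simp add: cont_funs_def)
  qed
  let ?b' = "\<lambda>f. if f \<in> FBL ?V ?N then ?b f else 0"
  have F: "sublattice (FBL ?V ?N)" using closed_sublattice_FBL[OF V] by (simp add: closed_sublattice_def)
  have Fs: "subspace (FBL ?V ?N)" and Fl: "\<And>x y. x \<in> FBL ?V ?N \<Longrightarrow> y \<in> FBL ?V ?N \<Longrightarrow> sup x y \<in> FBL ?V ?N \<and> inf x y \<in> FBL ?V ?N"
    using F by (simp_all add: sublattice_def)
  have "?N (?b' f) \<le> 1 * H0_norm ?V ?N f" if "f \<in> FBL ?V ?N" for f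
  proof -
    have "?N (?b f) \<le> 1 * H0_norm ?V ?N f"
      using abs_le_H0_norm[OF m(1)[OF that] b0] by (intro sup_norm_le) (simp_all add: H0_norm_def)
    then show ?thesis using that by simp
  qed
  then have "\<exists>C. \<forall>f\<in>FBL ?V ?N. ?N (?b' f) \<le> C * H0_norm ?V ?N f" by blast
  moreover have "?b' ` FBL ?V ?N \<subseteq> ?V" using m(2) by (intro image_subsetI) simp
  moreover have "\<forall>x\<in>FBL ?V ?N. \<forall>y\<in>FBL ?V ?N. ?b' (x + y) = ?b' x + ?b' y"
    using subspace_add[OF Fs] by (simp add: fun_eq_iff)
  moreover have "\<forall>x\<in>FBL ?V ?N. \<forall>c. ?b' (c *\<^sub>R x) = c *\<^sub>R ?b' x"
    using subspace_scale[OF Fs] by (simp add: fun_eq_iff)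
  moreover have "\<forall>x\<in>FBL ?V ?N. \<forall>y\<in>FBL ?V ?N. ?b' (sup x y) = sup (?b' x) (?b' y) \<and> ?b' (inf x y) = inf (?b' x) (?b' y)"
    using Fl by (simp add: fun_eq_iff)
  ultimately have hom: "lattice_homomorphism (FBL ?V ?N) (H0_norm ?V ?N) ?V ?N ?b'"
    unfolding lattice_homomorphism_def by (intro conjI)
  have dl: "?b' (fbl_delta ?V ?N h) = h" if h: "h \<in> ?V" for h
  proof -
    have "h t = 0" if "t \<notin> topspace K" for t using h that by (simp add: cont_funs_def)
    then show ?thesis using h d0 fbl_delta_in_FBL[OF h, of ?N] by (simp add: fbl_delta_def evaluation_def fun_eq_iff)
  qed
  have "fbl_beta ?V ?N = ?b'" by (rule fbl_beta_eqI[OF V hom dl]) (simp_all add: zero_fun_def)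
  with f show ?thesis by simp
qed

end

theory Submission
  imports Defs
begin

text \<open>
  A lattice lifting \<open>T\<close> turns every \<open>\<phi>\<close> of the dual ball into a lattice homomorphism \<open>h \<mapsto> T h \<phi>\<close> from
  \<open>C(K)\<close> to the reals, i.e. a nonnegative multiple of evaluation at a point of \<open>K\<close>. The factor is
  \<open>T 1 \<phi>\<close>, so where it is positive, dividing by it is a retraction onto the point evaluations; it is
  weak-star continuous since the elements of the free Banach lattice are.

  If \<open>K\<close> is metrizable, then a homeomorphism onto \<open>K\<close> from a closed subset of a compact Hausdorff space
  \<open>Y\<close> extends to a continuous map of \<open>Y\<close> into the dual ball: embed \<open>K\<close> into a countable power of the
  reals, extend the coordinates by Tietze, and apply a Dugundji extension operator. Composing with the
  retraction above makes that closed set a neighborhood retract of \<open>Y\<close>.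
\<close>

section \<open>Linear extension of continuous functions from a compact subset of a separable metric
  space\<close>

text \<open>
  Off \<open>C\<close>, the value at \<open>x\<close> is a weighted mean over a dense sequence in \<open>C\<close>; the weights \<open>w n x\<close> ignore
  points farther from \<open>x\<close> than twice the distance to \<open>C\<close>, which gives continuity at points of \<open>C\<close>
  without a partition of unity.
\<close>

lemma dugundji_extension_operator:
  fixes C :: "'a::{metric_space,second_countable_topology} set"
  assumes C: "compact C" "C \<noteq> {}"
  obtains L :: "('a \<Rightarrow> real) \<Rightarrow> 'a \<Rightarrow> real" where
    "\<And>h. continuous_on C h \<Longrightarrow> continuous_on UNIV (L h)"
    "\<And>h x. x \<in> C \<Longrightarrow> L h x = h x"
    "\<And>g h x. continuous_on C g \<Longrightarrow> continuous_on C h \<Longrightarrow> L (\<lambda>y. g y + h y) x = L g x + L h x"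
    "\<And>c h x. continuous_on C h \<Longrightarrow> L (\<lambda>y. c * h y) x = c * L h x"
    "\<And>h B x. continuous_on C h \<Longrightarrow> (\<And>y. y \<in> C \<Longrightarrow> \<bar>h y\<bar> \<le> B) \<Longrightarrow> \<bar>L h x\<bar> \<le> B"
proof -
  obtain S where S: "countable S" "S \<subseteq> C" "C \<subseteq> closure S"
    using separable by blast
  then have "S \<noteq> {}" using C by auto
  define k where "k = from_nat_into S"
  have kS: "range k = S" unfolding k_def using \<open>S \<noteq> {}\<close> S(1) by (rule range_from_nat_into)
  then have kC: "k n \<in> C" for n using S by auto
  have dense: "\<exists>n. dist (k n) a < e" if "a \<in> C" "e > 0" for a e
    using S(3) that kS unfolding closure_approachable by (metis closure_approachable rangeE subsetD)
  \<comment> \<open>The power of 1/2 makes series with bounded coefficients converge uniformly, and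
    the cap at 1 keeps that majorant valid. The positive part vanishes once \<open>k n\<close> is at
    distance \<open>2 * infdist x C\<close> or more from \<open>x\<close>, so every weight is 0 on
    \<open>C\<close> itself.\<close>
  define w where "w n x = (1/2)^n * min 1 (max 0 (2 * infdist x C - dist x (k n)))" for n :: nat and x
  define W where "W h x = (\<Sum>n. w n x * h (k n))" for h x
  \<comment> \<open>\<open>W (\<lambda>_. 1) x\<close> is the total weight at \<open>x\<close>. It
    is 0 on \<open>C\<close>, so the value there is prescribed separately.\<close>
  define L where "L h x = (if x \<in> C then h x else W h x / W (\<lambda>_. 1) x)" for h x
  have w0: "0 \<le> w n x" and w1: "w n x \<le> (1/2)^n" for n x
    unfolding w_def by (auto simp: mult_left_le)
  have bounded: "\<exists>B. \<forall>y\<in>C. \<bar>h y\<bar> \<le> B" if "continuous_on C h" for h :: "'a \<Rightarrow> real"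
    using compact_imp_bounded[OF compact_continuous_image[OF that C(1)]] by (auto simp: bounded_iff)
  have term_le: "norm (w n x * h (k n)) \<le> (1/2)^n * B" if "\<forall>y\<in>C. \<bar>h y\<bar> \<le> B" for h B n x
    using w0[of n x] w1[of n x] that kC[of n] by (auto simp: abs_mult intro: mult_mono)
  have geom: "summable (\<lambda>n. (1/2)^n * B)" for B :: real
    by (intro summable_mult2 summable_geometric) simp
  have sumW: "summable (\<lambda>n. w n x * h (k n))" if "continuous_on C h" for h x
  proof -
    obtain B where "\<forall>y\<in>C. \<bar>h y\<bar> \<le> B" using bounded \<open>continuous_on C h\<close> by blast
    then show ?thesis by (intro summable_comparison_test'[OF geom, of 0]) (rule term_le)
  qed
  have contW: "continuous_on UNIV (W h)" if "continuous_on C h" for h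
  proof -
    obtain B where B: "\<forall>y\<in>C. \<bar>h y\<bar> \<le> B" using bounded \<open>continuous_on C h\<close> by blast
    have "uniform_limit UNIV (\<lambda>n x. \<Sum>i<n. w i x * h (k i)) (\<lambda>x. \<Sum>i. w i x * h (k i)) sequentially"
      by (rule Weierstrass_m_test[OF term_le[OF B] geom])
    moreover have "continuous_on UNIV (\<lambda>x. \<Sum>i<n. w i x * h (k i))" for n
      unfolding w_def by (intro continuous_intros)
    ultimately show ?thesis unfolding W_def
      by (intro uniform_limit_theorem[where f = "\<lambda>n x. \<Sum>i<n. w i x * h (k i)"]) auto
  qed
  \<comment> \<open>As \<open>infdist x C\<close> is positive, some point of \<open>C\<close> lies
    strictly closer than twice this infimum. By density so does some \<open>k n\<close>, and its
    weight is then positive.\<close>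
  have pos: "W (\<lambda>_. 1) x > 0" if x: "x \<notin> C" for x
  proof -
    have "infdist x C > 0"
      using x C compact_imp_closed infdist_pos_not_in_closed by blast
    then have "(INF a\<in>C. dist x a) < 2 * infdist x C" using C(2) by (simp add: infdist_notempty)
    then obtain a where a: "a \<in> C" "dist x a < 2 * infdist x C"
      using C(2) by (subst (asm) cINF_less_iff) auto
    then obtain n where n: "dist (k n) a < 2 * infdist x C - dist x a" using dense by force
    have "dist x (k n) < 2 * infdist x C"
      using dist_triangle[of x "k n" a] n by (simp add: dist_commute)
    then have "w n x > 0" by (simp add: w_def)
    moreover have "summable (\<lambda>n. w n x)" using sumW[of "\<lambda>_. 1" x] by simp
    ultimately show ?thesis unfolding W_def using suminf_pos2[of "\<lambda>n. w n x" n] w0 by simp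
  qed
  have W_add: "W (\<lambda>y. g y + h y) x = W g x + W h x"
    if "continuous_on C g" "continuous_on C h" for g h x
    unfolding W_def using suminf_add[OF sumW[OF that(1)] sumW[OF that(2)]] by (simp add: distrib_left)
  have W_mult: "W (\<lambda>y. c * h y) x = c * W h x" if "continuous_on C h" for c h x
    unfolding W_def using suminf_mult[OF sumW[OF that], of c] by (simp add: mult.left_commute)
  \<comment> \<open>If all values that carry weight at \<open>x\<close> are within \<open>e\<close>
    of \<open>r\<close>, then so is their mean; this is that estimate multiplied by the total
    weight, and \<open>quot\<close> divides it out. Taking \<open>r = 0\<close> bounds the operator,
    and \<open>r = h a\<close> gives continuity at \<open>a\<close>.\<close>
  have local_bound: "\<bar>W h x - r * W (\<lambda>_. 1) x\<bar> \<le> e * W (\<lambda>_. 1) x"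
    if h: "continuous_on C h" and le: "\<And>n. w n x \<noteq> 0 \<Longrightarrow> \<bar>h (k n) - r\<bar> \<le> e" for h x r e
  proof -
    have *: "w n x * \<bar>h (k n) - r\<bar> \<le> e * w n x" for n
      using le[of n] w0[of n x] by (cases "w n x = 0") (auto simp: mult.commute intro: mult_right_mono)
    have sw: "summable (\<lambda>n. w n x)" using sumW[of "\<lambda>_. 1" x] by simp
    have h': "continuous_on C (\<lambda>y. \<bar>h y - r\<bar>)" by (intro continuous_intros h)
    have "W h x - r * W (\<lambda>_. 1) x = (\<Sum>n. w n x * (h (k n) - r))"
      unfolding W_def using suminf_diff[OF sumW[OF h, of x] summable_mult2[OF sw, of r]] suminf_mult2[OF sw, of r]
      by (simp add: right_diff_distrib mult.commute)
    also have "\<bar>\<dots>\<bar> \<le> (\<Sum>n. \<bar>w n x * (h (k n) - r)\<bar>)"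
      by (rule summable_rabs) (use sumW[OF h', of x] w0 in \<open>simp add: abs_mult\<close>)
    also have "\<dots> = (\<Sum>n. w n x * \<bar>h (k n) - r\<bar>)" using w0 by (simp add: abs_mult)
    also have "\<dots> \<le> (\<Sum>n. e * w n x)"
      by (rule suminf_le[OF * sumW[OF h'] summable_mult[OF sw]])
    also have "\<dots> = e * W (\<lambda>_. 1) x" unfolding W_def using suminf_mult[OF sw, of e] by simp
    finally show ?thesis .
  qed
  have quot: "\<bar>L h x - r\<bar> \<le> e"
    if h: "continuous_on C h" and x: "x \<notin> C" and le: "\<And>n. w n x \<noteq> 0 \<Longrightarrow> \<bar>h (k n) - r\<bar> \<le> e" for h x r e
  proof -
    have p: "W (\<lambda>_. 1) x > 0" by (rule pos[OF x])
    have "L h x - r = (W h x - r * W (\<lambda>_. 1) x) / W (\<lambda>_. 1) x"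
      using p x by (simp add: L_def field_simps)
    then have "\<bar>L h x - r\<bar> = \<bar>W h x - r * W (\<lambda>_. 1) x\<bar> / W (\<lambda>_. 1) x" using p by simp
    also have "\<dots> \<le> e" using local_bound[OF h le] p by (simp add: pos_divide_le_eq)
    finally show ?thesis .
  qed
  show ?thesis
  proof (rule that[of L])
    show "L h x = h x" if "x \<in> C" for h x using that by (simp add: L_def)
    show "L (\<lambda>y. g y + h y) x = L g x + L h x" if "continuous_on C g" "continuous_on C h" for g h x
      using W_add[OF that] by (simp add: L_def add_divide_distrib)
    show "L (\<lambda>y. c * h y) x = c * L h x" if "continuous_on C h" for c h x
      using W_mult[OF that] by (simp add: L_def)
    show "\<bar>L h x\<bar> \<le> B" if "continuous_on C h" "\<And>y. y \<in> C \<Longrightarrow> \<bar>h y\<bar> \<le> B" for h B x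
      using quot[OF that(1), of x 0 B] that(2) kC by (cases "x \<in> C") (auto simp: L_def)
    fix h :: "'a \<Rightarrow> real" assume h: "continuous_on C h"
    have opn: "open (- C)" using C compact_imp_closed by auto
    have "isCont (L h) a" for a
    proof (cases "a \<in> C")
      case False
      have "continuous_on (- C) (\<lambda>x. W h x / W (\<lambda>_. 1) x)"
        by (intro continuous_on_divide continuous_on_subset[OF contW] h) (use pos in force)+
      then have "continuous_on (- C) (L h)"
        by (rule continuous_on_eq) (simp add: L_def)
      then show ?thesis using opn False by (simp add: continuous_on_eq_continuous_at)
    next
      case True
      show ?thesis unfolding continuous_at_eps_delta
      proof (intro allI impI)
        fix e :: real assume "e > 0"
        then obtain d where d: "d > 0" "\<And>y. y \<in> C \<Longrightarrow> dist y a < d \<Longrightarrow> dist (h y) (h a) < e/2"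
          using h True unfolding continuous_on_iff by (metis half_gt_zero)
        \<comment> \<open>The constant 3: a \<open>k n\<close> with weight at \<open>x\<close>
          satisfies \<open>dist x (k n) < 2 * infdist x C \<le> 2 * dist x a\<close>, hence
          \<open>dist (k n) a < 3 * dist x a < d\<close>.\<close>
        have "dist (L h x) (L h a) < e" if x: "dist x a < d/3" for x
        proof (cases "x \<in> C")
          case True
          then have "dist (h x) (h a) < e/2" using d x by (intro d(2)) auto
          then show ?thesis using True \<open>a \<in> C\<close> \<open>e > 0\<close> by (simp add: L_def)
        next
          case False
          have "\<bar>L h x - h a\<bar> \<le> e/2"
          proof (rule quot[OF h False])
            fix n assume "w n x \<noteq> 0"
            then have "dist x (k n) < 2 * infdist x C" by (auto simp: w_def min_def max_def split: if_splits)
            also have "\<dots> \<le> 2 * dist x a" using infdist_le[OF True] by simp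
            finally have "dist (k n) a < d"
              using dist_triangle[of "k n" a x] x by (simp add: dist_commute)
            then show "\<bar>h (k n) - h a\<bar> \<le> e/2" using d(2)[OF kC] by (force simp: dist_real_def)
          qed
          then show ?thesis using True \<open>e > 0\<close> by (simp add: L_def dist_real_def)
        qed
        then show "\<exists>d>0. \<forall>x. dist x a < d \<longrightarrow> dist (L h x) (L h a) < e"
          using \<open>d > 0\<close> by (intro exI[of _ "d/3"]) auto
      qed
    qed
    then show "continuous_on UNIV (L h)" by (simp add: continuous_at_imp_continuous_on)
  qed
qed

section \<open>Separating sequences on compact metrizable spaces\<close>

text \<open>Total boundedness gives finite nets at every scale, whose union is countable and dense.
  A point is determined by its distances to a dense set, so these distance functions serve as the
  sequence.\<close>

lemma compact_metrizable_separating_sequence: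
  assumes "compact_space K" "metrizable_space K"
  obtains f :: "nat \<Rightarrow> 'a \<Rightarrow> real" where "\<And>n. continuous_map K euclideanreal (f n)"
    "\<And>s t. s \<in> topspace K \<Longrightarrow> t \<in> topspace K \<Longrightarrow> (\<And>n. f n s = f n t) \<Longrightarrow> s = t"
proof -
  obtain M d where "Metric_space M d" and K: "K = Metric_space.mtopology M d"
    using assms(2) by (auto simp: metrizable_space_def)
  then interpret Metric_space M d by simp
  have top_K: "topspace K = M" by (simp add: K)
  have "mtotally_bounded M"
    using assms(1) compact_space_eq_mcomplete_mtotally_bounded by (simp add: K)
  then have "\<forall>n::nat. \<exists>F. finite F \<and> F \<subseteq> M \<and> M \<subseteq> (\<Union>x\<in>F. mball x (1 / real (Suc n)))"
    unfolding mtotally_bounded_def by simp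
  then obtain F :: "nat \<Rightarrow> 'a set" where F: "\<And>n. finite (F n)" "\<And>n. F n \<subseteq> M"
      "\<And>n. M \<subseteq> (\<Union>x\<in>F n. mball x (1 / real (Suc n)))"
    by metis
  define D where "D = (\<Union>n. F n)"
  have D: "countable D" "D \<subseteq> M" using F by (auto simp: D_def countable_finite)
  have range: "\<exists>n. from_nat_into D n = c" if "c \<in> D" for c
    using from_nat_into_surj[OF D(1) that] .
  show ?thesis
  proof (cases "M = {}")
    case True
    have "topspace K = {}" by (rule trans[OF top_K True])
    show ?thesis
    proof (rule that[of "\<lambda>_ _. 0"])
      show "s = t" if "s \<in> topspace K" for s t
        using that \<open>topspace K = {}\<close> by blast
    qed simp
  next
    case False
    then have "F 0 \<noteq> {}" using F(3)[of 0] by auto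
    then have "D \<noteq> {}" by (auto simp: D_def)
    then have in_M: "from_nat_into D n \<in> M" for n by (rule subsetD[OF D(2) from_nat_into])
    show ?thesis
    proof (rule that[of "\<lambda>n. d (from_nat_into D n)"])
      fix n
      have "continuous_map mtopology euclideanreal (\<lambda>x. mdist (metric (M,d)) (from_nat_into D n) x)"
        by (intro continuous_map_mdist) (use in_M in \<open>simp_all add: mtopology_of_def\<close>)
      then show "continuous_map K euclideanreal (d (from_nat_into D n))" by (simp add: K)
    next
      fix s t assume st: "s \<in> topspace K" "t \<in> topspace K"
        and eq: "\<And>n. d (from_nat_into D n) s = d (from_nat_into D n) t"
      have s: "s \<in> M" "t \<in> M" using st by (auto simp: K)
      have "d s t \<le> 0 + e" if "e > 0" for e
      proof -
        \<comment> \<open>A net point \<open>c\<close> within \<open>e/2\<close> of \<open>s\<close>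
          is equally close to \<open>t\<close>, because its distances to both agree; hence
          \<open>s\<close> and \<open>t\<close> are less than \<open>e\<close> apart.\<close>
        obtain n where n: "inverse (real (Suc n)) < e/2" using reals_Archimedean[OF half_gt_zero[OF \<open>e > 0\<close>]] by blast
        obtain c where c: "c \<in> F n" "s \<in> mball c (1 / real (Suc n))" using F(3) s by blast
        then have "c \<in> D" by (auto simp: D_def)
        then have "d c s = d c t" using eq range by metis
        moreover have "d c s < e/2" using c n by (simp add: inverse_eq_divide)
        moreover have "d s t \<le> d c s + d c t" using triangle'[of s c t] c s by (simp add: commute)
        ultimately show ?thesis by simp
      qed
      then have "d s t \<le> 0" by (rule field_le_epsilon)
      then show "s = t" using s nonneg[of s t] zero by (metis order_antisym)
    qed
  qed
qed

section \<open>Weak-star continuity on the dual ball\<close>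

lemma topspace_weak_star_dual_ball [simp]: "topspace (weak_star_dual_ball V N) = dual_ball V N"
  by (simp add: weak_star_dual_ball_def)

lemma continuous_map_weak_star_dual_ball_iff:
  "continuous_map X (weak_star_dual_ball V N) \<mu> \<longleftrightarrow>
     (\<forall>x. continuous_map X euclideanreal (\<lambda>y. \<mu> y x)) \<and> \<mu> \<in> topspace X \<rightarrow> dual_ball V N"
  by (simp add: weak_star_dual_ball_def continuous_map_in_subtopology continuous_map_componentwise_UNIV)

lemma continuous_map_weak_star_apply:
  "continuous_map (weak_star_dual_ball V N) euclideanreal (\<lambda>\<phi>. \<phi> x)"
  using continuous_map_weak_star_dual_ball_iff[of "weak_star_dual_ball V N" V N id] by simp

text \<open>The weak-star continuous members of \<open>H0\<close> form a sublattice containing every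
  \<open>fbl_delta V N x\<close>. It is closed because one-element families in the definition of the
  norm show that norm convergence is uniform on the dual ball. As \<open>FBL\<close> is the least
  such closed sublattice, it lies inside.\<close>

lemma FBL_imp_weak_star_continuous:
  assumes V: "banach_lattice V N" and f: "f \<in> FBL V N"
  shows "continuous_map (weak_star_dual_ball V N) euclideanreal f"
proof -
  let ?X = "weak_star_dual_ball V N"
  let ?S = "{f \<in> H0 V N. continuous_map ?X euclideanreal f}"
  have "subspace V" using V by (simp add: banach_lattice_def sublattice_def)
  then have sH: "sublattice (H0 V N)" by (rule sublattice_H0)
  have latS: "sublattice ?S"
    using sH unfolding sublattice_def subspace_def plus_fun_def scaleR_fun_def sup_fun_def inf_fun_def zero_fun_def
    by (simp add: sup_max inf_min continuous_map_add continuous_map_real_max continuous_map_real_min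
        continuous_map_real_mult_left)
  have closedS: "f \<in> ?S" if f: "f \<in> H0 V N" and ap: "\<forall>e>0. \<exists>y\<in>?S. H0_norm V N (f - y) < e" for f
  proof -
    have "\<forall>n. \<exists>y. y \<in> ?S \<and> H0_norm V N (f - y) < inverse (real (Suc n))"
      using ap by (metis inverse_positive_iff_positive of_nat_0_less_iff zero_less_Suc)
    from choice[OF this] obtain y where y: "\<And>n::nat. y n \<in> ?S"
        "\<And>n. H0_norm V N (f - y n) < inverse (real (Suc n))"
      by blast
    have "continuous_map ?X Met_TC.mtopology f"
    proof (rule Met_TC.continuous_map_uniform_limit)
      show "\<forall>\<^sub>F n in sequentially. continuous_map ?X Met_TC.mtopology (y n)"
        using y by auto
      fix e :: real assume "e > 0"
      then obtain M where M: "inverse (real (Suc M)) < e" using reals_Archimedean by blast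
      have "dist (y n \<phi>) (f \<phi>) < e" if "n \<ge> M" "\<phi> \<in> dual_ball V N" for n \<phi>
      proof -
        have "f - y n \<in> H0 V N" using sH f y(1)[of n] by (simp add: sublattice_def subspace_diff)
        then have "\<bar>(f - y n) \<phi>\<bar> \<le> H0_norm V N (f - y n)" using that(2) by (rule abs_le_H0_norm)
        also have "\<dots> < inverse (real (Suc n))" by (rule y)
        also have "\<dots> \<le> inverse (real (Suc M))" using that by simp
        also note M
        finally show ?thesis by (simp add: dist_real_def abs_minus_commute del: of_nat_Suc)
      qed
      then show "\<forall>\<^sub>F n in sequentially. \<forall>\<phi>\<in>topspace ?X. f \<phi> \<in> UNIV \<and> dist (y n \<phi>) (f \<phi>) < e"
        unfolding eventually_sequentially by auto
    qed auto
    with f show ?thesis by simp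
  qed
  have "?S \<subseteq> H0 V N" by blast
  then have clS: "closed_sublattice (H0 V N) (H0_norm V N) ?S"
    unfolding closed_sublattice_def by (intro conjI ballI impI latS closedS)
  have "fbl_delta V N x \<in> ?S" if x: "x \<in> V" for x
  proof -
    have "continuous_map ?X euclideanreal (fbl_delta V N x)"
      by (rule continuous_map_eq[OF continuous_map_weak_star_apply[of V N x]])
        (auto simp: fbl_delta_def dual_ball_def)
    then show ?thesis using fbl_delta_in_H0[OF V x] by simp
  qed
  then have "FBL V N \<subseteq> ?S" by (intro FBL_least[OF clS] image_subsetI)
  then show ?thesis using f by blast
qed

section \<open>Real lattice homomorphisms on \<open>C(K)\<close>\<close>

lemma cont_funs_const: "(\<lambda>t. if t \<in> topspace K then c else 0) \<in> cont_funs K"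
proof -
  have "continuous_map K euclideanreal (\<lambda>t. if t \<in> topspace K then c else 0)"
    by (rule continuous_map_eq[of _ _ "\<lambda>_. c"]) auto
  then show ?thesis by (simp add: cont_funs_def)
qed

text \<open>
  If no point represented \<open>\<psi>\<close>, compactness would turn the functions \<open>\<bar>h - \<psi> h\<bar>\<close>, all in the
  kernel of \<open>\<psi>\<close>, into a kernel element dominating the constant 1.
\<close>

lemma lattice_functional_eq_point_evaluation:
  fixes K :: "'a topology" and \<psi> :: "('a \<Rightarrow> real) \<Rightarrow> real"
  assumes K: "compact_space K"
    and add: "\<And>g h. g \<in> cont_funs K \<Longrightarrow> h \<in> cont_funs K \<Longrightarrow> \<psi> (g + h) = \<psi> g + \<psi> h"
    and scale: "\<And>c h. h \<in> cont_funs K \<Longrightarrow> \<psi> (c *\<^sub>R h) = c * \<psi> h"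
    and sup: "\<And>g h. g \<in> cont_funs K \<Longrightarrow> h \<in> cont_funs K \<Longrightarrow> \<psi> (sup g h) = max (\<psi> g) (\<psi> h)"
    and one: "\<psi> (\<lambda>t. if t \<in> topspace K then 1 else 0) = 1"
  shows "\<exists>t\<in>topspace K. \<forall>h\<in>cont_funs K. \<psi> h = h t"
proof (rule ccontr)
  assume neg: "\<not> ?thesis"
  let ?V = "cont_funs K" and ?one = "\<lambda>t. if t \<in> topspace K then 1 else (0::real)"
  have V: "subspace ?V" and lat: "\<And>g h. g \<in> ?V \<Longrightarrow> h \<in> ?V \<Longrightarrow> sup g h \<in> ?V"
    using sublattice_cont_funs by (auto simp: sublattice_def)
  have one_V: "?one \<in> ?V" by (rule cont_funs_const)
  \<comment> \<open>The nonnegative elements of the kernel. They are closed under sums, so a finite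
    family of them has an upper bound among them.\<close>
  define Z where "Z = {g \<in> ?V. \<psi> g = 0 \<and> (\<forall>t. 0 \<le> g t)}"
  have Z_pos: "\<exists>g\<in>Z. 1 < g t" if t: "t \<in> topspace K" for t
  proof -
    obtain h where h: "h \<in> ?V" "\<psi> h \<noteq> h t" using neg t by blast
    \<comment> \<open>Subtracting the constant \<open>\<psi> h\<close> moves \<open>h\<close> into
      the kernel, since \<open>\<psi>\<close> is 1 at the constant 1, and leaves a nonzero value at
      \<open>t\<close>. Preservation of suprema keeps the absolute value \<open>a\<close> in the
      kernel.\<close>
    define g where "g = h + (- \<psi> h) *\<^sub>R ?one"
    have g: "g \<in> ?V" unfolding g_def using V h one_V by (intro subspace_add subspace_scale)
    have "\<psi> g = \<psi> h + (- \<psi> h) * \<psi> ?one"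
      unfolding g_def add[OF h(1) subspace_scale[OF V one_V, of "- \<psi> h"]] scale[OF one_V] ..
    then have "\<psi> g = 0" using one by simp
    define a where "a = sup g ((-1) *\<^sub>R g)"
    have a: "a \<in> ?V" unfolding a_def using V g by (intro lat subspace_scale)
    have "\<psi> a = max (\<psi> g) ((-1) * \<psi> g)"
      unfolding a_def sup[OF g subspace_scale[OF V g, of "-1"]] scale[OF g] ..
    then have "\<psi> a = 0" using \<open>\<psi> g = 0\<close> by simp
    have abs: "a s = \<bar>g s\<bar>" for s by (auto simp: a_def sup_max)
    have at: "a t > 0" using h t by (simp add: abs g_def)
    \<comment> \<open>This factor gives the rescaled function the value 2 at \<open>t\<close>, which
      leaves room for the open condition \<open>1 < g t\<close> used in the cover.\<close>
    define c where "c = 2 / a t"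
    have "c *\<^sub>R a \<in> Z" using V a \<open>\<psi> a = 0\<close> at by (simp add: Z_def subspace_scale scale abs c_def)
    moreover have "1 < (c *\<^sub>R a) t" using at by (simp add: c_def)
    ultimately show ?thesis by blast
  qed
  let ?P = "\<lambda>g. {t \<in> topspace K. 1 < g t}"
  have cover: "topspace K \<subseteq> \<Union>(?P ` Z)"
  proof
    fix t assume "t \<in> topspace K"
    with Z_pos show "t \<in> \<Union>(?P ` Z)" by simp
  qed
  have opn: "openin K {t \<in> topspace K. 1 < g t}" if "g \<in> Z" for g
  proof -
    have "continuous_map K euclideanreal g" using that by (simp add: Z_def cont_funs_def)
    from openin_continuous_map_preimage[OF this, of "{1<..}"] show ?thesis by simp
  qed
  have "(\<forall>U\<in>?P ` Z. openin K U) \<and> topspace K \<subseteq> \<Union>(?P ` Z)" using cover opn by simp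
  from K[unfolded compact_space_alt, rule_format, OF this]
  obtain \<F> where \<F>: "finite \<F>" "\<F> \<subseteq> ?P ` Z" "topspace K \<subseteq> \<Union>\<F>"
    by (elim exE conjE)
  obtain F where F: "F \<subseteq> Z" "finite F" and "\<F> = ?P ` F"
    using finite_subset_image[OF \<F>(1,2)] by (elim exE conjE)
  then have cov: "topspace K \<subseteq> \<Union>(?P ` F)" using \<F>(3) by simp
  have "\<exists>G\<in>Z. \<forall>g\<in>F. g \<le> G"
    using F(2,1)
  proof (induction F)
    case empty
    have "\<psi> (0 *\<^sub>R ?one) = 0" using scale[OF one_V, of 0] by simp
    then have "0 \<in> Z" using V by (simp add: Z_def subspace_0)
    then show ?case by blast
  next
    case (insert f F)
    then obtain G where G: "G \<in> Z" "\<forall>g\<in>F. g \<le> G" by auto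
    then have "G + f \<in> Z" using insert V by (auto simp: Z_def add subspace_add)
    moreover have "g \<le> G + f" if "g \<in> insert f F" for g
      using that G insert.prems by (force simp: Z_def le_fun_def add_increasing add_increasing2)
    ultimately show ?case by blast
  qed
  then obtain G where G: "G \<in> Z" "\<forall>g\<in>F. g \<le> G" by blast
  have "1 \<le> G t" if "t \<in> topspace K" for t
  proof -
    obtain g where "g \<in> F" "1 < g t" using cov \<open>t \<in> topspace K\<close> by auto
    then show ?thesis using le_funD[OF bspec[OF G(2)], of g t] by simp
  qed
  \<comment> \<open>\<open>G\<close> dominates 1 on \<open>K\<close> and is nonnegative elsewhere,
    where \<open>?one\<close> is 0. Applying \<open>\<psi>\<close> turns this equality into
    \<open>0 = max 0 1\<close>.\<close>
  then have "sup G ?one = G" using G by (intro ext) (auto simp: sup_max Z_def)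
  then have "\<psi> G = max (\<psi> G) 1" using sup[of G ?one] G one_V one by (simp add: Z_def)
  then show False using G by (simp add: Z_def)
qed

section \<open>The retraction defined by a lattice lifting\<close>

lemma lattice_lifting_imp_neighborhood_retract:
  assumes K: "compact_space K"
    and "lattice_lifting_property (cont_funs K) (sup_norm K)"
  shows "neighborhood_retract_of (evaluation K ` topspace K)
           (weak_star_dual_ball (cont_funs K) (sup_norm K))"
proof -
  let ?V = "cont_funs K" and ?N = "sup_norm K" and ?E = "evaluation K ` topspace K"
  let ?X = "weak_star_dual_ball ?V ?N" and ?one = "\<lambda>t. if t \<in> topspace K then 1 else (0::real)"
  obtain T where hom: "lattice_homomorphism ?V ?N (FBL ?V ?N) (H0_norm ?V ?N) T"
    and lift: "\<And>h. h \<in> ?V \<Longrightarrow> fbl_beta ?V ?N (T h) = h"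
    using assms(2) unfolding lattice_lifting_property_def by blast
  have TF: "T h \<in> FBL ?V ?N" if "h \<in> ?V" for h
    using hom that by (auto simp: lattice_homomorphism_def)
  have contT: "continuous_map ?X euclideanreal (T h)" if "h \<in> ?V" for h
    by (rule FBL_imp_weak_star_continuous[OF banach_lattice_cont_funs[OF K] TF[OF that]])
  \<comment> \<open>Since \<open>fbl_beta\<close> evaluates at the point evaluations, the lifting
    identity says precisely that \<open>T h\<close> restricts to \<open>h\<close> on the copy of
    \<open>K\<close>. This is what makes \<open>r\<close> fix that copy.\<close>
  have T_ev: "T h (evaluation K t) = h t" if "h \<in> ?V" "t \<in> topspace K" for h t
    using fun_cong[OF fbl_beta_cont_funs[OF K TF[OF that(1)]], of t] that lift by simp
  have one_V: "?one \<in> ?V" by (rule cont_funs_const)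
  have V: "subspace ?V" using sublattice_cont_funs by (auto simp: sublattice_def)
  \<comment> \<open>Open because \<open>T ?one\<close> is weak-star continuous, and a neighborhood
    of the copy of \<open>K\<close> because \<open>T ?one\<close> is 1 there.\<close>
  define U where "U = {\<phi> \<in> dual_ball ?V ?N. T ?one \<phi> > 0}"
  \<comment> \<open>The value 0 off \<open>C(K)\<close> matches the representation of functionals,
    so that \<open>r \<phi>\<close> can equal an evaluation as a total function.\<close>
  define r where "r \<phi> h = (if h \<in> ?V then T h \<phi> / T ?one \<phi> else 0)" for \<phi> h
  have "openin ?X U"
    using openin_continuous_map_preimage[OF contT[OF one_V], of "{0<..}"] by (simp add: U_def)
  moreover have EU: "?E \<subseteq> U"
    using evaluation_in_dual_ball[OF K] T_ev[OF one_V] by (auto simp: U_def)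
  moreover have "?E retract_of_space subtopology ?X U"
    unfolding retract_of_space_def
  proof (intro conjI exI[of _ r])
    show "?E \<subseteq> topspace (subtopology ?X U)" using EU by (auto simp: U_def)
    show "\<forall>\<phi>\<in>?E. r \<phi> = \<phi>"
      using T_ev T_ev[OF one_V] by (auto simp: r_def evaluation_def fun_eq_iff)
    have rE: "r \<phi> \<in> ?E" if "\<phi> \<in> U" for \<phi>
    proof -
      have p: "T ?one \<phi> > 0" using that by (simp add: U_def)
      have "\<exists>t\<in>topspace K. \<forall>h\<in>?V. r \<phi> h = h t"
      proof (rule lattice_functional_eq_point_evaluation[OF K])
        fix g h assume gh: "g \<in> ?V" "h \<in> ?V"
        show "r \<phi> (g + h) = r \<phi> g + r \<phi> h"
          using hom gh V by (simp add: r_def lattice_homomorphism_def subspace_add add_divide_distrib)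
        have "sup g h \<in> ?V" "T (sup g h) = sup (T g) (T h)"
          using hom gh sublattice_cont_funs[of K] by (auto simp: lattice_homomorphism_def sublattice_def)
        then show "r \<phi> (sup g h) = max (r \<phi> g) (r \<phi> h)"
          using gh p by (simp add: r_def sup_max max_divide_distrib_right)
      next
        fix c h assume "h \<in> ?V"
        then show "r \<phi> (c *\<^sub>R h) = c * r \<phi> h"
          using hom V by (simp add: r_def lattice_homomorphism_def subspace_scale)
      next
        show "r \<phi> ?one = 1" using one_V p by (simp add: r_def)
      qed
      then obtain t where "t \<in> topspace K" "\<And>h. h \<in> ?V \<Longrightarrow> r \<phi> h = h t" by blast
      then have "r \<phi> = evaluation K t" by (auto simp: evaluation_def r_def)
      then show ?thesis using \<open>t \<in> topspace K\<close> by blast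
    qed
    have "continuous_map (subtopology ?X U) euclideanreal (\<lambda>\<phi>. r \<phi> h)" for h
    proof (cases "h \<in> ?V")
      case True
      then have "continuous_map (subtopology ?X U) euclideanreal (\<lambda>\<phi>. T h \<phi> / T ?one \<phi>)"
        using contT one_V
        by (intro continuous_map_real_divide continuous_map_from_subtopology) (auto simp: U_def)
      then show ?thesis using True by (simp add: r_def)
    qed (simp add: r_def)
    moreover have "?E \<subseteq> dual_ball ?V ?N" using evaluation_in_dual_ball[OF K] by blast
    ultimately have "continuous_map (subtopology ?X U) ?X r"
      using rE by (auto simp: continuous_map_weak_star_dual_ball_iff)
    then show "continuous_map (subtopology ?X U) (subtopology (subtopology ?X U) ?E) r"
      using rE EU by (auto simp: continuous_map_in_subtopology)
  qed
  ultimately show ?thesis unfolding neighborhood_retract_of_def by blast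
qed

section \<open>The metrizable case: absolute neighborhood retracts\<close>

text \<open>Functionals on \<open>C(K)\<close> can be averaged although points of \<open>K\<close>
  cannot: \<open>\<mu> y\<close> transports \<open>h\<close> to an embedded copy of
  \<open>K\<close>, applies the linear extension operator and reads the result at
  \<open>E y\<close>, where \<open>E\<close> extends the embedding composed with \<open>g\<close> to
  all of \<open>Y\<close>.\<close>

lemma evaluation_extends_to_dual_ball:
  fixes K :: "'a topology" and Y :: "'b topology"
  assumes K: "compact_space K" "metrizable_space K" "topspace K \<noteq> {}"
    and Y: "normal_space Y" "closedin Y A"
    and g: "continuous_map (subtopology Y A) K g"
  obtains \<mu> where "continuous_map Y (weak_star_dual_ball (cont_funs K) (sup_norm K)) \<mu>"
    "\<And>a. a \<in> A \<Longrightarrow> \<mu> a = evaluation K (g a)"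
proof -
  let ?V = "cont_funs K" and ?N = "sup_norm K"
  have A: "A \<subseteq> topspace Y" using Y(2) by (rule closedin_subset)
  then have gA: "g a \<in> topspace K" if "a \<in> A" for a
    using g that by (auto simp: continuous_map_def)
  obtain f :: "nat \<Rightarrow> 'a \<Rightarrow> real" where f: "\<And>n. continuous_map K euclideanreal (f n)"
      and sep: "\<And>s t. s \<in> topspace K \<Longrightarrow> t \<in> topspace K \<Longrightarrow> (\<And>n. f n s = f n t) \<Longrightarrow> s = t"
    using compact_metrizable_separating_sequence[OF K(1,2)] by blast
  define e where "e t = (\<lambda>n. f n t)" for t
  define C where "C = e ` topspace K"
  define i where "i = inv_into (topspace K) e"
  have e: "continuous_map K euclidean e"
    unfolding euclidean_product_topology[symmetric] continuous_map_componentwise_UNIV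
    using f by (simp add: e_def)
  have inj: "inj_on e (topspace K)"
    by (rule inj_onI, rule sep) (auto simp: e_def dest: fun_cong)
  have i: "i (e t) = t" if "t \<in> topspace K" for t
    unfolding i_def using inj that by (rule inv_into_f_f)
  have "compact C"
    using image_compactin[OF _ e] K(1) by (simp add: C_def compact_space_def)
  moreover have "C \<noteq> {}" using K(3) by (simp add: C_def)
  ultimately obtain L :: "((nat \<Rightarrow> real) \<Rightarrow> real) \<Rightarrow> (nat \<Rightarrow> real) \<Rightarrow> real" where
    L: "\<And>h. continuous_on C h \<Longrightarrow> continuous_on UNIV (L h)"
      "\<And>h x. x \<in> C \<Longrightarrow> L h x = h x"
      "\<And>g h x. continuous_on C g \<Longrightarrow> continuous_on C h \<Longrightarrow> L (\<lambda>y. g y + h y) x = L g x + L h x"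
      "\<And>c h x. continuous_on C h \<Longrightarrow> L (\<lambda>y. c * h y) x = c * L h x"
      "\<And>h B x. continuous_on C h \<Longrightarrow> (\<And>y. y \<in> C \<Longrightarrow> \<bar>h y\<bar> \<le> B) \<Longrightarrow> \<bar>L h x\<bar> \<le> B"
    using dugundji_extension_operator[of C] by blast
  \<comment> \<open>A continuous injection of a compact space into a Hausdorff space has a
    continuous inverse on its image.\<close>
  have "continuous_map (top_of_set C) K i"
    using e i by (intro continuous_inverse_map[where f = e and X = K] K(1)) (simp_all add: C_def)
  then have hi: "continuous_on C (\<lambda>x. h (i x))" if "h \<in> ?V" for h
    using continuous_map_compose[of "top_of_set C" K i euclideanreal h] that
    by (simp add: cont_funs_def o_def)
  have "\<exists>E. continuous_map Y euclideanreal E \<and> (\<forall>a\<in>A. E a = f n (g a))" for n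
  proof -
    have "continuous_map (subtopology Y A) euclideanreal (\<lambda>a. f n (g a))"
      using continuous_map_compose[OF g f, of n] by (simp add: o_def)
    then obtain E where "continuous_map Y euclideanreal E" "\<And>a. a \<in> A \<Longrightarrow> E a = f n (g a)"
      by (rule Tietze_extension_realinterval[OF Y is_interval_univ UNIV_not_empty _ subset_UNIV]) (rule that)
    then show ?thesis by (intro exI[of _ E]) simp
  qed
  then obtain E0 where E0: "\<And>n::nat. continuous_map Y euclideanreal (E0 n)"
    "\<And>n a. a \<in> A \<Longrightarrow> E0 n a = f n (g a)"
    by metis
  define E where "E y = (\<lambda>n. E0 n y)" for y
  have E: "continuous_map Y euclidean E"
    unfolding euclidean_product_topology[symmetric] continuous_map_componentwise_UNIV
    using E0 by (simp add: E_def)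
  have EA: "E a = e (g a)" if "a \<in> A" for a using E0(2)[OF that] by (simp add: E_def e_def)
  define \<mu> where "\<mu> y h = (if h \<in> ?V then L (\<lambda>x. h (i x)) (E y) else 0)" for y h
  have V: "subspace ?V" using sublattice_cont_funs by (auto simp: sublattice_def)
  \<comment> \<open>The extension operator does not increase bounds, which places each
    \<open>\<mu> y\<close> in the unit ball and not merely in the dual space.\<close>
  have bound: "\<bar>\<mu> y h\<bar> \<le> ?N h" if "h \<in> ?V" for y h
    unfolding \<mu>_def using that L(5)[OF hi[OF that]] abs_le_sup_norm[OF K(1) that] by simp
  then have "\<exists>B. \<forall>h\<in>?V. \<bar>\<mu> y h\<bar> \<le> B * ?N h" for y by (intro exI[of _ 1]) simp
  moreover have "\<mu> y (h1 + h2) = \<mu> y h1 + \<mu> y h2" if "h1 \<in> ?V" "h2 \<in> ?V" for y h1 h2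
    using that V L(3)[OF hi hi, OF that] by (simp add: \<mu>_def subspace_add)
  moreover have "\<mu> y (c *\<^sub>R h) = c * \<mu> y h" if "h \<in> ?V" for y c h
    using that V L(4)[OF hi, OF that] by (simp add: \<mu>_def subspace_scale)
  ultimately have "\<mu> y \<in> dual_space ?V ?N" for y
    by (simp add: dual_space_def \<mu>_def)
  then have ball: "\<mu> y \<in> dual_ball ?V ?N" for y
    using bound by (auto simp: dual_ball_def intro: order_trans)
  show ?thesis
  proof (rule that[of \<mu>])
    have "continuous_map Y euclideanreal (\<lambda>y. \<mu> y h)" for h
    proof (cases "h \<in> ?V")
      case True
      then have "continuous_map euclidean euclideanreal (L (\<lambda>x. h (i x)))"
        using L(1)[OF hi] by simp
      from continuous_map_compose[OF E this] show ?thesis using True by (simp add: \<mu>_def o_def)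
    qed (simp add: \<mu>_def)
    then show "continuous_map Y (weak_star_dual_ball ?V ?N) \<mu>"
      using ball by (simp add: continuous_map_weak_star_dual_ball_iff)
    fix a assume a: "a \<in> A"
    then have "e (g a) \<in> C" using gA by (simp add: C_def)
    then show "\<mu> a = evaluation K (g a)"
      using a L(2) i[OF gA] by (auto simp: \<mu>_def evaluation_def EA)
  qed
qed

text \<open>The copy of \<open>K\<close> is Hausdorff and \<open>K\<close> is compact, so continuity
  and injectivity suffice. Injectivity comes from the separating sequence, set to 0 off
  \<open>K\<close> so that its terms lie in \<open>cont_funs K\<close>.\<close>

lemma homeomorphic_map_evaluation:
  assumes K: "compact_space K" "metrizable_space K"
  shows "homeomorphic_map K
    (subtopology (weak_star_dual_ball (cont_funs K) (sup_norm K)) (evaluation K ` topspace K)) (evaluation K)"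
proof -
  let ?V = "cont_funs K" and ?N = "sup_norm K" and ?E = "evaluation K ` topspace K"
  let ?X = "weak_star_dual_ball ?V ?N"
  have E: "?E \<subseteq> dual_ball ?V ?N" using evaluation_in_dual_ball[OF K(1)] by blast
  have "continuous_map K euclideanreal (\<lambda>t. evaluation K t h)" for h
    by (cases "h \<in> ?V") (auto simp: evaluation_def cont_funs_def)
  then have cont: "continuous_map K ?X (evaluation K)"
    using E by (auto simp: continuous_map_weak_star_dual_ball_iff)
  obtain f :: "nat \<Rightarrow> 'a \<Rightarrow> real" where f: "\<And>n. continuous_map K euclideanreal (f n)"
      and sep: "\<And>s t. s \<in> topspace K \<Longrightarrow> t \<in> topspace K \<Longrightarrow> (\<And>n. f n s = f n t) \<Longrightarrow> s = t"
    using compact_metrizable_separating_sequence[OF K] by blast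
  have inj: "inj_on (evaluation K) (topspace K)"
  proof (intro inj_onI sep)
    fix s t n assume st: "s \<in> topspace K" "t \<in> topspace K" and eq: "evaluation K s = evaluation K t"
    let ?h = "\<lambda>t. if t \<in> topspace K then f n t else 0"
    have "continuous_map K euclideanreal ?h" by (rule continuous_map_eq[OF f[of n]]) simp
    then have "?h \<in> ?V" by (simp add: cont_funs_def)
    then show "f n s = f n t" using fun_cong[OF eq, of ?h] st by (simp add: evaluation_def)
  qed
  have "Hausdorff_space (powertop_real (UNIV :: ('a \<Rightarrow> real) set))"
    by (simp add: Hausdorff_space_product_topology)
  then have "Hausdorff_space (subtopology ?X ?E)"
    by (simp add: weak_star_dual_ball_def Hausdorff_space_subtopology)
  then show ?thesis
    using cont K(1) inj E
    by (intro continuous_imp_homeomorphic_map) (auto simp: continuous_map_in_subtopology)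
qed

lemma neighborhood_retract_imp_compact_ANR:
  fixes K :: "'a topology"
  assumes K: "compact_space K" "metrizable_space K"
    and nr: "neighborhood_retract_of (evaluation K ` topspace K)
           (weak_star_dual_ball (cont_funs K) (sup_norm K))"
  shows "compact_ANR TYPE('b) K"
proof -
  let ?V = "cont_funs K" and ?N = "sup_norm K" and ?E = "evaluation K ` topspace K"
  let ?X = "weak_star_dual_ball ?V ?N"
  obtain U where U: "openin ?X U" "?E \<subseteq> U" and "?E retract_of_space subtopology ?X U"
    using nr unfolding neighborhood_retract_of_def by (elim exE conjE)
  then obtain r where r: "continuous_map (subtopology ?X U) (subtopology (subtopology ?X U) ?E) r"
      "\<forall>\<phi>\<in>?E. r \<phi> = \<phi>"
    unfolding retract_of_space_def by (elim exE conjE)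
  have nbd: "neighborhood_retract_of A Y"
    if Y: "compact_space Y" "Hausdorff_space Y" "A \<subseteq> topspace Y"
      and hom: "subtopology Y A homeomorphic_space K" for Y :: "'b topology" and A
  proof (cases "topspace K = {}")
    \<comment> \<open>An empty \<open>K\<close> forces \<open>A\<close> to be empty, and the empty
      set is then its own neighborhood; the extension into the dual ball assumes a nonempty
      \<open>K\<close>.\<close>
    case True
    then have "topspace (subtopology Y A) = {}" using homeomorphic_empty_space[OF hom] by simp
    then have "A = {}" using Y(3) by (simp only: topspace_subtopology Int_absorb1)
    then show ?thesis unfolding neighborhood_retract_of_def by (intro exI[of _ "{}"]) simp
  next
    case False
    obtain g k where gk: "homeomorphic_maps (subtopology Y A) K g k"
      using hom by (auto simp: homeomorphic_space_def)
    then have g: "continuous_map (subtopology Y A) K g" and k: "continuous_map K (subtopology Y A) k"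
      and kg: "\<And>a. a \<in> A \<Longrightarrow> k (g a) = a"
      using Y(3) by (auto simp: homeomorphic_maps_def)
    \<comment> \<open>Compactness of \<open>A\<close> makes it closed in the Hausdorff space
      \<open>Y\<close>; with normality of \<open>Y\<close> this permits the Tietze
      extension.\<close>
    have "compactin Y A"
      using homeomorphic_compact_space[OF hom] K(1) Y(3) by (simp add: compactin_subspace)
    then have closed: "closedin Y A" using Y(2) by (simp add: compactin_imp_closedin)
    have normal: "normal_space Y"
      by (rule compact_Hausdorff_or_regular_imp_normal_space[OF Y(1) disjI1[OF Y(2)]])
    obtain \<mu> where \<mu>: "continuous_map Y ?X \<mu>" "\<And>a. a \<in> A \<Longrightarrow> \<mu> a = evaluation K (g a)"
      by (rule evaluation_extends_to_dual_ball[OF K False normal closed g]) (rule that)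
    obtain v where v: "homeomorphic_maps K (subtopology ?X ?E) (evaluation K) v"
      using homeomorphic_map_evaluation[OF K] unfolding homeomorphic_map_maps by (elim exE)
    then have v_cont: "continuous_map (subtopology ?X ?E) K v"
      and v_ev: "\<And>t. t \<in> topspace K \<Longrightarrow> v (evaluation K t) = t"
      by (auto simp: homeomorphic_maps_def)
    define W where "W = {y \<in> topspace Y. \<mu> y \<in> U}"
    have "openin Y W" unfolding W_def by (rule openin_continuous_map_preimage[OF \<mu>(1) U(1)])
    moreover have gA: "g a \<in> topspace K" if "a \<in> A" for a
      using g that Y(3) by (auto simp: continuous_map_def)
    then have "A \<subseteq> W" using \<mu>(2) U(2) Y(3) by (auto simp: W_def)
    moreover have "A retract_of_space subtopology Y W"
      unfolding retract_of_space_def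
    \<comment> \<open>\<open>\<mu>\<close> sends \<open>W\<close> into \<open>U\<close>,
      \<open>r\<close> retracts onto the evaluations, \<open>v\<close> recovers the point of
      \<open>K\<close> and \<open>k\<close> carries it back to \<open>A\<close>. For
      \<open>a\<close> in \<open>A\<close>, \<open>\<mu> a\<close> is already an evaluation, so
      \<open>r\<close> fixes it and the composition returns \<open>k (g a) = a\<close>.\<close>
    proof (intro conjI exI[of _ "k \<circ> v \<circ> r \<circ> \<mu>"] ballI)
      show "A \<subseteq> topspace (subtopology Y W)" using \<open>A \<subseteq> W\<close> Y(3) by auto
      have 1: "continuous_map (subtopology Y W) (subtopology ?X U) \<mu>"
        using \<mu>(1) by (auto simp: continuous_map_in_subtopology continuous_map_from_subtopology W_def)
      have 2: "continuous_map (subtopology ?X U) (subtopology ?X ?E) r"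
        using r(1) U(2) by (simp add: subtopology_subtopology Int_absorb1)
      have "continuous_map (subtopology Y W) (subtopology Y A) (k \<circ> v \<circ> r \<circ> \<mu>)"
        using continuous_map_compose[OF 1 continuous_map_compose[OF 2 continuous_map_compose[OF v_cont k]]]
        by (simp add: o_assoc)
      then show "continuous_map (subtopology Y W) (subtopology (subtopology Y W) A) (k \<circ> v \<circ> r \<circ> \<mu>)"
        using \<open>A \<subseteq> W\<close> by (simp add: subtopology_subtopology Int_absorb1)
      fix a assume a: "a \<in> A"
      then show "(k \<circ> v \<circ> r \<circ> \<mu>) a = a"
        using gA[OF a] \<mu>(2)[OF a] r(2) v_ev kg by simp
    qed
    ultimately show ?thesis unfolding neighborhood_retract_of_def by (intro exI[of _ W] conjI)
  qed
  show ?thesis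
    unfolding compact_ANR_def
  proof (intro conjI allI impI)
    show "Hausdorff_space K" by (rule metrizable_imp_Hausdorff_space[OF K(2)])
  qed (fact K(1), elim conjE, rule nbd)
qed

theorem theorem3p2:
  fixes K :: "'a topology"
  assumes "compact_space K" and "Hausdorff_space K"
    and "lattice_lifting_property (cont_funs K) (sup_norm K)"
  shows "neighborhood_retract_of (evaluation K ` topspace K)
           (weak_star_dual_ball (cont_funs K) (sup_norm K)) \<and>
         (metrizable_space K \<longrightarrow> compact_ANR TYPE('b) K)"
proof -
  have nr: "neighborhood_retract_of (evaluation K ` topspace K)
      (weak_star_dual_ball (cont_funs K) (sup_norm K))"
    by (rule lattice_lifting_imp_neighborhood_retract) fact+
  then show ?thesis
    using neighborhood_retract_imp_compact_ANR[OF assms(1) _ nr] by blast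
qed

end
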